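(* Let $K$ be a finite simplicial complex. For all simplices $\sigma\le\tau$ of $K$, the homology group $H_i\big([\Delta K^{-*}\otimes_{\mathbb{Z}(K)}\Delta K](\sigma\le\tau)\big)$ is zero for $i>0$ and is infinite cyclic for $i=0$. In fact the chain map $$\varepsilon:[\Delta K^{-*}\otimes_{\mathbb{Z}(K)}\Delta K]\to\underline{\mathbb{Z}}^{DK}$$ of $\mathbb{Z}[DK]$-chain complexes is a weak equivalence.
   Context: **Posets.** $K$ is regarded as the poset of its (nonempty) simplices under inclusion; $K^{\mathrm{op}}$ is the opposite poset. $DK$ is the poset whose objects are pairs $(\sigma\le\tau)$ of simplices of $K$ with $\sigma$ a face of $\tau$, with $(\sigma\le\tau)\le(\sigma'\le\tau')$ iff $\sigma'\le\sigma\le\tau\le\tau'$. **Categories.** For a finite poset $P$ (viewed as a category), $\mathbb{Z}[P]\text{-mod}$ is the category of functors from $P$ to abelian groups. $\mathbb{Z}(P)\text{-mod}$ has objects $M=\bigoplus_{x\in P}M(x)$ with each $M(x)$ finitely generated free abelian, and morphisms $M\to N$ the homomorphisms $f$ with $f(M(y))\subset\bigoplus_{x\le_P y}N(x)$; the component $M(y)\to N(x)$ is written $f_{x\le y}$. Define $[\ ]:\mathbb{Z}(P)\text{-mod}\to\mathbb{Z}[P]\text{-mod}$ by $[M](x)=\bigoplus_{y\le_P x}M(y)$, with structure maps the inclusions and $[f](x)$ the restriction of $f$. $\mathrm{Ch}$ denotes chain complexes with finitely many nonzero terms. A chain map $f:C\to D$ of $\mathbb{Z}[P]$-chain complexes is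 a weak equivalence if $f(x):C(x)\to D(x)$ is an isomorphism on homology for every $x\in P$. **Simplicial chains and cochains.** Orient the simplices of $K$. $\Delta K\in\mathrm{Ch}(\mathbb{Z}(K)\text{-mod})$ is the simplicial chain complex, with $\Delta K(\tau)\cong\mathbb{Z}$ generated by $\tau$ in degree $|\tau|=\dim\tau$. Its dual $\Delta K^{-*}\in\mathrm{Ch}(\mathbb{Z}(K^{\mathrm{op}})\text{-mod})$ has $\Delta K^{-*}(\sigma)\cong\mathbb{Z}$ generated by the dual basis element $\widehat\sigma$ in degree $-|\sigma|$, with differential $f\mapsto(-1)^{|f|+1}f\circ\partial$. **Round tensor product.** For $M\in\mathbb{Z}(K^{\mathrm{op}})\text{-mod}$, $N\in\mathbb{Z}(K)\text{-mod}$, $M\otimes_{\mathbb{Z}(K)}N\in\mathbb{Z}(DK)\text{-mod}$ is given by $(M\otimes_{\mathbb{Z}(K)}N)(\sigma\le\tau)=M(\sigma)\otimes_{\mathbb{Z}}N(\tau)$, and on morphisms the component from the $(\sigma'\le\tau')$-summand to the $(\sigma\le\tau)$-summand, for $(\sigma\le\tau)\le(\sigma'\le\tau')$, is $f_{\sigma'\le\sigma}\otimes g_{\tau\le\tau'}$, where $f_{\sigma'\le\sigma}:M(\sigma')\to M'(\sigma)$ and $g_{\tau\le\tau'}:N(\tau')\to N'(\tau)$ are the components. It is extended to chain complexes by totalization with $d(x\otimes y)=dx\otimes y+(-1)^{|x|}x\otimes dy$. Thus $[\Delta K^{-*}\otimes_{\mathbb{Z}(K)}\Delta K](\sigma\le\tau)$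 is free abelian on the elements $\widehat{\sigma'}\otimes\tau'$ with $\sigma\le\sigma'\le\tau'\le\tau$. **Augmentation.** $\underline{\mathbb{Z}}^{DK}$ is the constant $\mathbb{Z}[DK]$-module with value $\mathbb{Z}$ (and identity structure maps), placed in degree $0$. The chain map $\varepsilon$ is determined by $\varepsilon(\widehat\sigma\otimes\sigma)=1$ for every simplex $\sigma$ and $\varepsilon(\widehat\sigma\otimes\tau)=0$ if $\sigma$ is a proper face of $\tau$. *)

theory Defs
  imports
    "HOL-Algebra.Free_Abelian_Groups"
    "HOL-Algebra.Order"
    "HOL-Combinatorics.Permutations"
begin

section \<open>Simplicial complexes and posets\<close>

definition finite_simplicial_complex :: "'v set set \<Rightarrow> bool" where
  "finite_simplicial_complex K \<longleftrightarrow>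
     finite K \<and> (\<forall>\<sigma>\<in>K. finite \<sigma> \<and> \<sigma> \<noteq> {}) \<and>
     (\<forall>\<sigma>\<in>K. \<forall>\<rho>. \<rho> \<noteq> {} \<and> \<rho> \<subseteq> \<sigma> \<longrightarrow> \<rho> \<in> K)"

definition simplex_dim :: "'v set \<Rightarrow> int" where
  "simplex_dim \<sigma> = int (card \<sigma>) - 1"

definition face_poset :: "'v set set \<Rightarrow> 'v set gorder" where
  "face_poset K = \<lparr>carrier = K, eq = (=), le = (\<subseteq>)\<rparr>"

text \<open>For \<open>P = face_poset K\<close> this is the poset \<open>DK\<close>.\<close>

definition D_poset :: "('p, 'e) gorder_scheme \<Rightarrow> ('p \<times> 'p) gorder" where
  "D_poset P =
     \<lparr>carrier = {(x, y). x \<in> carrier P \<and> y \<in> carrier P \<and> x \<sqsubseteq>\<^bsub>P\<^esub> y},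
      eq = (=),
      le = (\<lambda>(x, y) (x', y'). x' \<sqsubseteq>\<^bsub>P\<^esub> x \<and> x \<sqsubseteq>\<^bsub>P\<^esub> y \<and> y \<sqsubseteq>\<^bsub>P\<^esub> y')\<rparr>"

lemma partial_order_face_poset: "partial_order (face_poset K)"
  by unfold_locales (auto simp: face_poset_def)

lemma partial_order_D_poset:
  assumes "partial_order P"
  shows "partial_order (D_poset P)"
proof -
  interpret partial_order P by fact
  show ?thesis
    by unfold_locales
      (auto simp: D_poset_def intro: le_refl le_trans le_antisym)
qed


section \<open>Chain complexes of abelian groups and homology\<close>

text \<open>Groups are written multiplicatively by the library; the zero element is \<open>\<one>\<close>.\<close>

record 'a chain_complex =
  chain_group :: "int \<Rightarrow> 'a monoid"
  boundary :: "int \<Rightarrow> 'a \<Rightarrow> 'a"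

definition cycle_group :: "'a chain_complex \<Rightarrow> int \<Rightarrow> 'a monoid" where
  "cycle_group C n =
     subgroup_generated (chain_group C n)
       (kernel (chain_group C n) (chain_group C (n - 1)) (boundary C n))"

definition boundaries :: "'a chain_complex \<Rightarrow> int \<Rightarrow> 'a set" where
  "boundaries C n = boundary C (n + 1) ` carrier (chain_group C (n + 1))"

definition homology :: "'a chain_complex \<Rightarrow> int \<Rightarrow> 'a set monoid" where
  "homology C n = cycle_group C n Mod boundaries C n"

text \<open>The product below is \<open>B + f(X)\<close>, which for a class \<open>X = B' + z\<close> is \<open>B + f(z)\<close>.\<close>

definition homology_map ::
  "'b chain_complex \<Rightarrow> int \<Rightarrow> ('a \<Rightarrow> 'b) \<Rightarrow> 'a set \<Rightarrow> 'b set" where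
  "homology_map D n f X = boundaries D n <#>\<^bsub>chain_group D n\<^esub> (f ` X)"


section \<open>The category of functors from a poset to abelian groups\<close>

record ('p, 'a) pmodule =
  pm_at :: "'p \<Rightarrow> 'a monoid"
  pm_map :: "'p \<Rightarrow> 'p \<Rightarrow> 'a \<Rightarrow> 'a"

definition is_pmodule :: "('p, 'e) gorder_scheme \<Rightarrow> ('p, 'a) pmodule \<Rightarrow> bool" where
  "is_pmodule P M \<longleftrightarrow>
     (\<forall>x\<in>carrier P. comm_group (pm_at M x)) \<and>
     (\<forall>x\<in>carrier P. \<forall>y\<in>carrier P. x \<sqsubseteq>\<^bsub>P\<^esub> y \<longrightarrow> pm_map M x y \<in> hom (pm_at M x) (pm_at M y)) \<and>
     (\<forall>x\<in>carrier P. \<forall>m\<in>carrier (pm_at M x). pm_map M x x m = m) \<and>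
     (\<forall>x\<in>carrier P. \<forall>y\<in>carrier P. \<forall>z\<in>carrier P. x \<sqsubseteq>\<^bsub>P\<^esub> y \<and> y \<sqsubseteq>\<^bsub>P\<^esub> z \<longrightarrow>
        (\<forall>m\<in>carrier (pm_at M x). pm_map M y z (pm_map M x y m) = pm_map M x z m))"

definition is_pmodule_hom ::
  "('p, 'e) gorder_scheme \<Rightarrow> ('p, 'a) pmodule \<Rightarrow> ('p, 'b) pmodule \<Rightarrow> ('p \<Rightarrow> 'a \<Rightarrow> 'b) \<Rightarrow> bool" where
  "is_pmodule_hom P M N f \<longleftrightarrow>
     (\<forall>x\<in>carrier P. f x \<in> hom (pm_at M x) (pm_at N x)) \<and>
     (\<forall>x\<in>carrier P. \<forall>y\<in>carrier P. x \<sqsubseteq>\<^bsub>P\<^esub> y \<longrightarrow>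
        (\<forall>m\<in>carrier (pm_at M x). f y (pm_map M x y m) = pm_map N x y (f x m)))"

record ('p, 'a) pmodule_complex =
  pc_module :: "int \<Rightarrow> ('p, 'a) pmodule"
  pc_boundary :: "int \<Rightarrow> 'p \<Rightarrow> 'a \<Rightarrow> 'a"

definition pc_at :: "('p, 'a) pmodule_complex \<Rightarrow> 'p \<Rightarrow> 'a chain_complex" where
  "pc_at C x = \<lparr>chain_group = (\<lambda>n. pm_at (pc_module C n) x), boundary = (\<lambda>n. pc_boundary C n x)\<rparr>"

definition is_pmodule_complex ::
  "('p, 'e) gorder_scheme \<Rightarrow> ('p, 'a) pmodule_complex \<Rightarrow> bool" where
  "is_pmodule_complex P C \<longleftrightarrow>
     (\<forall>n. is_pmodule P (pc_module C n)) \<and>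
     (\<forall>n. is_pmodule_hom P (pc_module C n) (pc_module C (n - 1)) (pc_boundary C n)) \<and>
     (\<forall>n. \<forall>x\<in>carrier P. \<forall>m\<in>carrier (pm_at (pc_module C n) x).
        pc_boundary C (n - 1) x (pc_boundary C n x m) = \<one>\<^bsub>pm_at (pc_module C (n - 2)) x\<^esub>) \<and>
     finite {n. \<exists>x\<in>carrier P. \<not> trivial_group (pm_at (pc_module C n) x)}"

definition is_chain_map ::
  "('p, 'e) gorder_scheme \<Rightarrow> ('p, 'a) pmodule_complex \<Rightarrow> ('p, 'b) pmodule_complex \<Rightarrow>
     (int \<Rightarrow> 'p \<Rightarrow> 'a \<Rightarrow> 'b) \<Rightarrow> bool" where
  "is_chain_map P C D f \<longleftrightarrow>
     is_pmodule_complex P C \<and> is_pmodule_complex P D \<and>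
     (\<forall>n. is_pmodule_hom P (pc_module C n) (pc_module D n) (f n)) \<and>
     (\<forall>n. \<forall>x\<in>carrier P. \<forall>m\<in>carrier (pm_at (pc_module C n) x).
        f (n - 1) x (pc_boundary C n x m) = pc_boundary D n x (f n x m))"

definition weak_equivalence ::
  "('p, 'e) gorder_scheme \<Rightarrow> ('p, 'a) pmodule_complex \<Rightarrow> ('p, 'b) pmodule_complex \<Rightarrow>
     (int \<Rightarrow> 'p \<Rightarrow> 'a \<Rightarrow> 'b) \<Rightarrow> bool" where
  "weak_equivalence P C D f \<longleftrightarrow>
     is_chain_map P C D f \<and>
     (\<forall>x\<in>carrier P. \<forall>n.
        homology_map (pc_at D x) n (f n x) \<in> iso (homology (pc_at C x) n) (homology (pc_at D x) n))"

definition constant_integers :: "('p, int) pmodule_complex" where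
  "constant_integers =
     \<lparr>pc_module = (\<lambda>n. \<lparr>pm_at = (\<lambda>x. if n = 0 then integer_group else singleton_group 0),
                        pm_map = (\<lambda>x y m. m)\<rparr>),
      pc_boundary = (\<lambda>n x m. 0)\<rparr>"


section \<open>Modules and chain complexes graded by a poset\<close>

text \<open>
  An object \<open>M = \<Oplus>\<^sub>x M(x)\<close> with all \<open>M(x)\<close> finitely generated free is given by a set of free
  generators of \<open>M\<close>, each located at a point of the poset: \<open>M(x)\<close> is the free abelian group on
  the generators located at \<open>x\<close>, and \<open>M\<close> is the free abelian group on all generators. A chain
  complex is such an object with a degree for each generator and a differential on \<open>\<Oplus>\<^sub>n C\<^sub>n\<close>.
\<close>

record ('p, 'b) graded_module =
  gens :: "'b set"
  loc :: "'b \<Rightarrow> 'p"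

record ('p, 'b) graded_complex = "('p, 'b) graded_module" +
  deg :: "'b \<Rightarrow> int"
  diff :: "('b \<Rightarrow>\<^sub>0 int) \<Rightarrow> ('b \<Rightarrow>\<^sub>0 int)"

definition part_at :: "('p, 'b, 'm) graded_module_scheme \<Rightarrow> 'p \<Rightarrow> ('b \<Rightarrow>\<^sub>0 int) \<Rightarrow> ('b \<Rightarrow>\<^sub>0 int)" where
  "part_at M x = frag_extend (\<lambda>b. if loc M b = x then frag_of b else 0)"

definition degree_part :: "('p, 'b) graded_complex \<Rightarrow> int \<Rightarrow> ('p, 'b) graded_module" where
  "degree_part C n = \<lparr>gens = {b \<in> gens C. deg C b = n}, loc = loc C\<rparr>"

text \<open>The functor \<open>[ ]\<close>, on objects and on chain complexes.\<close>

definition bracket ::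
  "('p, 'e) gorder_scheme \<Rightarrow> ('p, 'b, 'm) graded_module_scheme \<Rightarrow> ('p, 'b \<Rightarrow>\<^sub>0 int) pmodule" where
  "bracket P M =
     \<lparr>pm_at = (\<lambda>x. free_Abelian_group {b \<in> gens M. loc M b \<sqsubseteq>\<^bsub>P\<^esub> x}),
      pm_map = (\<lambda>x y m. m)\<rparr>"

definition bracket_complex ::
  "('p, 'e) gorder_scheme \<Rightarrow> ('p, 'b) graded_complex \<Rightarrow> ('p, 'b \<Rightarrow>\<^sub>0 int) pmodule_complex" where
  "bracket_complex P C =
     \<lparr>pc_module = (\<lambda>n. bracket P (degree_part C n)), pc_boundary = (\<lambda>n x. diff C)\<rparr>"

definition minus_one_pow :: "int \<Rightarrow> int" where
  "minus_one_pow n = (if even n then 1 else - 1)"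

text \<open>
  In the dual complex the generator \<open>b\<close> stands for the dual basis element, which sends \<open>u\<close> to
  \<open>lookup u b\<close>. A functional \<open>\<phi>\<close> is written in the dual basis via its values on the basis.
\<close>

definition in_dual_basis :: "'b set \<Rightarrow> (('b \<Rightarrow>\<^sub>0 int) \<Rightarrow> int) \<Rightarrow> ('b \<Rightarrow>\<^sub>0 int)" where
  "in_dual_basis B \<phi> = (\<Sum>c\<in>B. frag_cmul (\<phi> (frag_of c)) (frag_of c))"

definition dual_complex :: "('p, 'b) graded_complex \<Rightarrow> ('p, 'b) graded_complex" where
  "dual_complex C =
     \<lparr>gens = gens C, loc = loc C, deg = (\<lambda>b. - deg C b),
      diff = frag_extend (\<lambda>b. frag_cmul (minus_one_pow (- deg C b + 1))
               (in_dual_basis (gens C) (\<lambda>u. Poly_Mapping.lookup (diff C u) b)))\<rparr>"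


section \<open>The round tensor product\<close>

text \<open>The tensor product of the free abelian groups on \<open>A\<close> and \<open>B\<close> is the free abelian group on
  \<open>A \<times> B\<close>, with the following universal bilinear map.\<close>

definition frag_tensor :: "('a \<Rightarrow>\<^sub>0 int) \<Rightarrow> ('b \<Rightarrow>\<^sub>0 int) \<Rightarrow> ('a \<times> 'b \<Rightarrow>\<^sub>0 int)" where
  "frag_tensor u v = frag_extend (\<lambda>a. frag_extend (\<lambda>b. frag_of (a, b)) v) u"

lemma frag_tensor_of [simp]: "frag_tensor (frag_of a) (frag_of b) = frag_of (a, b)"
  by (simp add: frag_tensor_def)

lemma frag_tensor_add_left: "frag_tensor (u + u') v = frag_tensor u v + frag_tensor u' v"
  by (simp add: frag_tensor_def frag_extend_add)

lemma frag_tensor_add_right: "frag_tensor u (v + v') = frag_tensor u v + frag_tensor u v'"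
  by (simp add: frag_tensor_def frag_extend_add) (simp add: frag_extend_def frag_cmul_distrib2 sum.distrib)

lemma hom_free_Abelian_group_eqI:
  assumes "group G" and h: "h \<in> hom (free_Abelian_group S) G" and k: "k \<in> hom (free_Abelian_group S) G"
    and eq: "\<And>s. s \<in> S \<Longrightarrow> h (frag_of s) = k (frag_of s)" and "Poly_Mapping.keys u \<subseteq> S"
  shows "h u = k u"
proof -
  interpret h: group_hom "free_Abelian_group S" G h
    using assms by (simp add: group_hom_def group_hom_axioms_def)
  interpret k: group_hom "free_Abelian_group S" G k
    using assms by (simp add: group_hom_def group_hom_axioms_def)
  have "Poly_Mapping.keys u \<subseteq> S \<and> h u = k u"
    using \<open>Poly_Mapping.keys u \<subseteq> S\<close>
  proof (induction rule: frag_induction)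
    case zero
    then show ?case
      using h.hom_one k.hom_one by simp
  next
    case (one x)
    then show ?case by (simp add: eq)
  next
    case (diff a b)
    have sub: "Poly_Mapping.keys (a - b) \<subseteq> S"
      using diff keys_diff[of a b] by blast
    have "h ((a - b) + b) = k ((a - b) + b)" "h b = k b"
      using diff by simp_all
    then have "h (a - b) \<otimes>\<^bsub>G\<^esub> h b = k (a - b) \<otimes>\<^bsub>G\<^esub> h b"
      using h.hom_mult[of "a - b" b] k.hom_mult[of "a - b" b] diff sub by simp
    moreover have "h (a - b) \<in> carrier G" "k (a - b) \<in> carrier G" "h b \<in> carrier G"
      using h.hom_closed[of "a - b"] k.hom_closed[of "a - b"] h.hom_closed[of b] diff sub by simp_all
    ultimately show ?case
      using sub h.H.right_cancel by blast
  qed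
  then show ?thesis ..
qed

lemma keys_frag_tensor: "Poly_Mapping.keys (frag_tensor u v) \<subseteq> Poly_Mapping.keys u \<times> Poly_Mapping.keys v"
proof -
  have "Poly_Mapping.keys (frag_extend (\<lambda>b. frag_of (a, b)) v) \<subseteq> {a} \<times> Poly_Mapping.keys v" for a :: 'a
    using keys_frag_extend[of "\<lambda>b. frag_of (a, b)" v] by fastforce
  then show ?thesis
    using keys_frag_extend[of "\<lambda>a. frag_extend (\<lambda>b. frag_of (a, b)) v" u]
    unfolding frag_tensor_def by fastforce
qed

lemma frag_tensor_universal:
  assumes G: "comm_group G"
    and left: "\<And>v. Poly_Mapping.keys v \<subseteq> B \<Longrightarrow> (\<lambda>u. \<beta> u v) \<in> hom (free_Abelian_group A) G"
    and right: "\<And>u. Poly_Mapping.keys u \<subseteq> A \<Longrightarrow> \<beta> u \<in> hom (free_Abelian_group B) G"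
  obtains h where "h \<in> hom (free_Abelian_group (A \<times> B)) G"
    and "\<And>u v. \<lbrakk>Poly_Mapping.keys u \<subseteq> A; Poly_Mapping.keys v \<subseteq> B\<rbrakk> \<Longrightarrow> h (frag_tensor u v) = \<beta> u v"
    and "\<And>h' w. \<lbrakk>h' \<in> hom (free_Abelian_group (A \<times> B)) G;
           \<And>u v. \<lbrakk>Poly_Mapping.keys u \<subseteq> A; Poly_Mapping.keys v \<subseteq> B\<rbrakk> \<Longrightarrow> h' (frag_tensor u v) = \<beta> u v;
           Poly_Mapping.keys w \<subseteq> A \<times> B\<rbrakk> \<Longrightarrow> h' w = h w"
proof -
  interpret G: comm_group G by fact
  have "(\<lambda>(a, b). \<beta> (frag_of a) (frag_of b)) ` (A \<times> B) \<subseteq> carrier G"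
    using hom_in_carrier[OF right] by fastforce
  then obtain h where h: "h \<in> hom (free_Abelian_group (A \<times> B)) G"
    and h_of: "\<And>x. x \<in> A \<times> B \<Longrightarrow> h (frag_of x) = (case x of (a, b) \<Rightarrow> \<beta> (frag_of a) (frag_of b))"
    using G.free_Abelian_group_universal[of "\<lambda>(a, b). \<beta> (frag_of a) (frag_of b)" "A \<times> B"] by blast
  have h_mult: "h (x + y) = h x \<otimes>\<^bsub>G\<^esub> h y"
    if "Poly_Mapping.keys x \<subseteq> A \<times> B" "Poly_Mapping.keys y \<subseteq> A \<times> B" for x y
    using hom_mult[OF h] that by simp
  have h_carr: "h x \<in> carrier G" if "Poly_Mapping.keys x \<subseteq> A \<times> B" for x
    using hom_in_carrier[OF h] that by simp
  have keys: "Poly_Mapping.keys (frag_tensor u v) \<subseteq> A \<times> B"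
    if "Poly_Mapping.keys u \<subseteq> A" "Poly_Mapping.keys v \<subseteq> B" for u v
    using keys_frag_tensor[of u v] that by blast
  have of_left: "h (frag_tensor (frag_of a) v) = \<beta> (frag_of a) v"
    if a: "a \<in> A" and v: "Poly_Mapping.keys v \<subseteq> B" for a v
  proof (rule hom_free_Abelian_group_eqI[where S = B and G = G])
    show "(\<lambda>v. h (frag_tensor (frag_of a) v)) \<in> hom (free_Abelian_group B) G"
      using a by (intro homI) (auto simp: frag_tensor_add_right h_mult keys h_carr)
  qed (use a v in \<open>auto simp: right h_of\<close>)
  have tensor: "h (frag_tensor u v) = \<beta> u v"
    if u: "Poly_Mapping.keys u \<subseteq> A" and v: "Poly_Mapping.keys v \<subseteq> B" for u v
  proof (rule hom_free_Abelian_group_eqI[where S = A and G = G])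
    show "(\<lambda>u. h (frag_tensor u v)) \<in> hom (free_Abelian_group A) G"
      using v by (intro homI) (auto simp: frag_tensor_add_left h_mult keys h_carr)
  qed (use u v in \<open>auto simp: left of_left\<close>)
  have unique: "h' w = h w"
    if h': "h' \<in> hom (free_Abelian_group (A \<times> B)) G"
      and eq: "\<And>u v. \<lbrakk>Poly_Mapping.keys u \<subseteq> A; Poly_Mapping.keys v \<subseteq> B\<rbrakk> \<Longrightarrow> h' (frag_tensor u v) = \<beta> u v"
      and w: "Poly_Mapping.keys w \<subseteq> A \<times> B" for h' w
  proof (rule hom_free_Abelian_group_eqI[OF _ h' h _ w])
    show "h' (frag_of s) = h (frag_of s)" if "s \<in> A \<times> B" for s
      using that eq[of "frag_of (fst s)" "frag_of (snd s)"] h_of[of s] by (auto simp: case_prod_beta)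
  qed simp
  show thesis
    using that h tensor unique by blast
qed

definition round_tensor ::
  "('p, 'e) gorder_scheme \<Rightarrow> ('p, 'a, 'm) graded_module_scheme \<Rightarrow> ('p, 'b, 'n) graded_module_scheme \<Rightarrow>
     ('p \<times> 'p, 'a \<times> 'b) graded_module" where
  "round_tensor P M N =
     \<lparr>gens = {(a, b). a \<in> gens M \<and> b \<in> gens N \<and> (loc M a, loc N b) \<in> carrier (D_poset P)},
      loc = (\<lambda>(a, b). (loc M a, loc N b))\<rparr>"

text \<open>The morphism \<open>f \<otimes> g\<close> for \<open>f : M \<rightarrow> M'\<close> and \<open>g : N \<rightarrow> N'\<close>; the value on a generator \<open>(a, b)\<close>
  located at \<open>(x', y')\<close> collects the components at all \<open>(x, y) \<le> (x', y')\<close>.\<close>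

definition round_tensor_hom ::
  "('p, 'e) gorder_scheme \<Rightarrow>
     ('p, 'a, 'm) graded_module_scheme \<Rightarrow> ('p, 'b, 'n) graded_module_scheme \<Rightarrow>
     ('p, 'c, 'k) graded_module_scheme \<Rightarrow> ('p, 'd, 'l) graded_module_scheme \<Rightarrow>
     (('a \<Rightarrow>\<^sub>0 int) \<Rightarrow> ('c \<Rightarrow>\<^sub>0 int)) \<Rightarrow> (('b \<Rightarrow>\<^sub>0 int) \<Rightarrow> ('d \<Rightarrow>\<^sub>0 int)) \<Rightarrow>
     ('a \<times> 'b \<Rightarrow>\<^sub>0 int) \<Rightarrow> ('c \<times> 'd \<Rightarrow>\<^sub>0 int)" where
  "round_tensor_hom P M N M' N' f g =
     frag_extend (\<lambda>(a, b).
       \<Sum>(x, y) \<in> {z \<in> carrier (D_poset P). z \<sqsubseteq>\<^bsub>D_poset P\<^esub> (loc M a, loc N b)}.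
         frag_tensor (part_at M' x (f (frag_of a))) (part_at N' y (g (frag_of b))))"

definition round_tensor_complex ::
  "('p, 'e) gorder_scheme \<Rightarrow> ('p, 'a) graded_complex \<Rightarrow> ('p, 'b) graded_complex \<Rightarrow>
     ('p \<times> 'p, 'a \<times> 'b) graded_complex" where
  "round_tensor_complex P C D =
     \<lparr>gens = gens (round_tensor P C D),
      loc = loc (round_tensor P C D),
      deg = (\<lambda>(a, b). deg C a + deg D b),
      diff = frag_extend (\<lambda>(a, b).
        round_tensor_hom P C D C D (diff C) id (frag_of (a, b)) +
        frag_cmul (minus_one_pow (deg C a))
          (round_tensor_hom P C D C D id (diff D) (frag_of (a, b))))\<rparr>"


section \<open>Simplicial chains and cochains\<close>

text \<open>An orientation is an ordering of the vertices of each simplex, which matters only up to even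
  permutations; a list \<open>xs\<close> denotes the simplex \<open>set xs\<close> with a sign comparing \<open>xs\<close> to the chosen
  ordering, and the empty list denotes \<open>0\<close>.\<close>

definition orientation :: "'v set set \<Rightarrow> ('v set \<Rightarrow> 'v list) \<Rightarrow> bool" where
  "orientation K ori \<longleftrightarrow> (\<forall>\<sigma>\<in>K. distinct (ori \<sigma>) \<and> set (ori \<sigma>) = \<sigma>)"

definition reordering_sign :: "'v list \<Rightarrow> 'v list \<Rightarrow> int" where
  "reordering_sign xs ys = sign (THE p. p permutes set xs \<and> map p xs = ys)"

definition oriented_simplex :: "('v set \<Rightarrow> 'v list) \<Rightarrow> 'v list \<Rightarrow> ('v set \<Rightarrow>\<^sub>0 int)" where
  "oriented_simplex ori xs =
     (if xs = [] then 0
      else frag_cmul (reordering_sign (ori (set xs)) xs) (frag_of (set xs)))"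

definition simplicial_boundary :: "('v set \<Rightarrow> 'v list) \<Rightarrow> ('v set \<Rightarrow>\<^sub>0 int) \<Rightarrow> ('v set \<Rightarrow>\<^sub>0 int)" where
  "simplicial_boundary ori =
     frag_extend (\<lambda>\<tau>. \<Sum>i<length (ori \<tau>).
       frag_cmul ((- 1) ^ i) (oriented_simplex ori (take i (ori \<tau>) @ drop (Suc i) (ori \<tau>))))"

definition simplicial_chains ::
  "'v set set \<Rightarrow> ('v set \<Rightarrow> 'v list) \<Rightarrow> ('v set, 'v set) graded_complex" where
  "simplicial_chains K ori =
     \<lparr>gens = K, loc = (\<lambda>\<tau>. \<tau>), deg = simplex_dim, diff = simplicial_boundary ori\<rparr>"

definition simplicial_cochains ::
  "'v set set \<Rightarrow> ('v set \<Rightarrow> 'v list) \<Rightarrow> ('v set, 'v set) graded_complex" where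
  "simplicial_cochains K ori = dual_complex (simplicial_chains K ori)"

definition cochains_tensor_chains ::
  "'v set set \<Rightarrow> ('v set \<Rightarrow> 'v list) \<Rightarrow>
     ('v set \<times> 'v set, 'v set \<times> 'v set \<Rightarrow>\<^sub>0 int) pmodule_complex" where
  "cochains_tensor_chains K ori =
     bracket_complex (D_poset (face_poset K))
       (round_tensor_complex (face_poset K) (simplicial_cochains K ori) (simplicial_chains K ori))"

definition augmentation ::
  "int \<Rightarrow> 'v set \<times> 'v set \<Rightarrow> ('v set \<times> 'v set \<Rightarrow>\<^sub>0 int) \<Rightarrow> int" where
  "augmentation n x u =
     (\<Sum>(\<sigma>, \<tau>)\<in>Poly_Mapping.keys u. Poly_Mapping.lookup u (\<sigma>, \<tau>) * (if \<sigma> = \<tau> then 1 else 0))"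

lemma chain_group_cochains_tensor_chains:
  assumes "\<sigma> \<in> K" "\<tau> \<in> K" "\<sigma> \<subseteq> \<tau>"
  shows "chain_group (pc_at (cochains_tensor_chains K ori) (\<sigma>, \<tau>)) n =
    free_Abelian_group {(\<sigma>', \<tau>'). \<sigma>' \<in> K \<and> \<tau>' \<in> K \<and> \<sigma> \<subseteq> \<sigma>' \<and> \<sigma>' \<subseteq> \<tau>' \<and> \<tau>' \<subseteq> \<tau> \<and>
      simplex_dim \<tau>' - simplex_dim \<sigma>' = n}"
  by (auto simp: cochains_tensor_chains_def pc_at_def bracket_complex_def bracket_def
      degree_part_def round_tensor_complex_def round_tensor_def simplicial_cochains_def
      dual_complex_def simplicial_chains_def D_poset_def face_poset_def
      intro!: arg_cong[where f = free_Abelian_group])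

lemma lookup_diff_simplicial_cochains:
  assumes "finite K" "\<rho> \<in> K"
  shows "Poly_Mapping.lookup (diff (simplicial_cochains K ori) (frag_of \<sigma>)) \<rho> =
    minus_one_pow (- simplex_dim \<sigma> + 1) *
    Poly_Mapping.lookup (simplicial_boundary ori (frag_of \<rho>)) \<sigma>"
  using assms
  by (simp add: simplicial_cochains_def dual_complex_def simplicial_chains_def in_dual_basis_def
      lookup_sum if_distrib cong: if_cong)

end

theory Submission
  imports Defs
begin

text \<open>
  Fix \<open>\<sigma> \<le> \<tau>\<close>. The value of the complex at \<open>(\<sigma>, \<tau>)\<close> has the generators \<open>(a, b)\<close> with
  \<open>\<sigma> \<subseteq> a \<subseteq> b \<subseteq> \<tau>\<close>, in degree \<open>dim b - dim a\<close>, and its differential is the sum of a coboundary that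
  enlarges \<open>a\<close> inside \<open>b\<close> and a boundary that shrinks \<open>b\<close> down to \<open>a\<close>. Filter it by the dimension of
  \<open>b\<close>. In the filtration quotients only the coboundary remains, so the column over \<open>b\<close> is the augmented
  cochain complex of the full simplex on the vertex set \<open>b - \<sigma>\<close>, up to a shift. It is contractible unless
  \<open>b = \<sigma>\<close>, and the column over \<open>\<sigma>\<close> is just \<open>\<int>\<close>, generated by \<open>(\<sigma>, \<sigma>)\<close> in degree zero. Hence the
  homology is \<open>\<int>\<close> in degree zero, generated by \<open>(\<sigma>, \<sigma>)\<close>, and the augmentation maps this generator to \<open>1\<close>.

  The contraction of the column over \<open>b \<noteq> \<sigma>\<close> chooses a vertex \<open>v\<close> in \<open>b - \<sigma>\<close> and deletes it from \<open>a\<close>, with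
  a sign (\<open>column_contraction\<close>). On the whole complex it is a contracting homotopy up to terms \<open>(a', b')\<close>
  with \<open>b'\<close> smaller than \<open>b\<close>. Subtracting the boundary of the contraction from a cycle therefore pushes
  the cycle down the filtration, until it is a multiple of \<open>(\<sigma>, \<sigma>)\<close> (\<open>cycle_homologous_to_bottom\<close>). With
  the fact that the augmentation vanishes on boundaries this gives both injectivity and surjectivity on
  homology (\<open>augmentation_homology_iso\<close>); the homology groups are then those of the constant complex.

  The orientation enters through the incidence numbers, the coefficients of the simplicial boundary. What
  the proof takes from them is that they vanish away from facets, they are \<open>\<plusminus> 1\<close> on facets
  (\<open>incidence_square\<close>), and the two ways of removing two vertices have opposite signs
  (\<open>incidence_anticommute\<close>).
\<close>

section \<open>Signs of reorderings\<close>

lemma reordering_sign_map: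
  assumes "distinct xs" and "p permutes set xs"
  shows "reordering_sign xs (map p xs) = sign p"
proof -
  have "q = p" if "q permutes set xs" "map q xs = map p xs" for q
  proof
    fix x show "q x = p x"
      using that assms(2) by (cases "x \<in> set xs") (auto simp: permutes_not_in)
  qed
  then have "(THE q. q permutes set xs \<and> map q xs = map p xs) = p"
    using assms(2) by (intro the_equality) auto
  then show ?thesis
    by (simp add: reordering_sign_def)
qed

lemma obtain_reordering:
  assumes "distinct xs" "distinct ys" "set ys = set xs"
  obtains p where "p permutes set xs" "map p xs = ys"
proof -
  let ?n = "length xs"
  have len: "length ys = ?n"
    using assms by (metis distinct_card)
  have bx: "bij_betw ((!) xs) {..<?n} (set xs)" and bY: "bij_betw ((!) ys) {..<?n} (set xs)"
    using assms len by (auto intro!: bij_betw_nth)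
  define q where "q = (!) ys \<circ> the_inv_into {..<?n} ((!) xs)"
  define p where "p x = (if x \<in> set xs then q x else x)" for x
  have "bij_betw q (set xs) (set xs)"
    unfolding q_def by (rule bij_betw_trans[OF bij_betw_the_inv_into[OF bx] bY])
  then have "bij_betw p (set xs) (set xs)"
    by (rule bij_betw_cong[THEN iffD1, rotated]) (simp add: p_def)
  then have "p permutes set xs"
    by (rule bij_imp_permutes) (simp add: p_def)
  moreover have "map p xs = ys"
    using len bx by (auto intro!: nth_equalityI simp: p_def q_def bij_betw_def the_inv_into_f_f)
  ultimately show thesis ..
qed

lemma reordering_sign_square:
  "reordering_sign xs ys * reordering_sign xs ys = 1"
  by (simp add: reordering_sign_def)

text \<open>
  Signs of reorderings form a cocycle on the orderings of a fixed vertex set, so any two orderings may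
  be compared through a third one.
\<close>

lemma reordering_sign_trans:
  assumes "distinct xs" "distinct ys" "distinct zs" "set ys = set xs" "set zs = set xs"
  shows "reordering_sign xs ys * reordering_sign ys zs = reordering_sign xs zs"
proof -
  obtain p where p: "p permutes set xs" "map p xs = ys"
    using obtain_reordering assms(1,2,4) by blast
  obtain q where q: "q permutes set ys" "map q ys = zs"
    using obtain_reordering[of ys zs] assms by auto
  have "permutation p" "permutation q"
    using p(1) q(1) permutes_imp_permutation by blast+
  then have "sign (q \<circ> p) = sign p * sign q"
    by (simp add: sign_compose)
  moreover have "reordering_sign xs (map (q \<circ> p) xs) = sign (q \<circ> p)"
    using assms p q by (intro reordering_sign_map permutes_compose) auto
  moreover have "map (q \<circ> p) xs = zs"
    using p q by auto
  ultimately show ?thesis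
    using reordering_sign_map[OF assms(1) p(1)] reordering_sign_map[OF assms(2) q(1)] p q by simp
qed

lemma reordering_sign_Cons:
  assumes "distinct (v # xs)" "distinct (v # ys)" "set ys = set xs"
  shows "reordering_sign (v # xs) (v # ys) = reordering_sign xs ys"
proof -
  obtain p where p: "p permutes set xs" "map p xs = ys"
    using obtain_reordering[of xs ys] assms by auto
  have "p permutes set (v # xs)"
    using p(1) by (rule permutes_subset) auto
  moreover have "p v = v"
    using p(1) assms(1) by (auto simp: permutes_not_in)
  ultimately show ?thesis
    using reordering_sign_map[of "v # xs" p] reordering_sign_map[of xs p] p assms by auto
qed

lemma reordering_sign_swap:
  assumes "distinct (v # w # xs)"
  shows "reordering_sign (v # w # xs) (w # v # xs) = -1"
proof -
  have "transpose v w permutes set (v # w # xs)"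
    by (rule permutes_swap_id) auto
  moreover have "map (transpose v w) xs = xs"
    using assms by (intro map_idI) (auto simp: transpose_def)
  ultimately show ?thesis
    using reordering_sign_map[OF assms, of "transpose v w"] assms by (simp add: sign_swap_id)
qed

text \<open>
  The entry \<open>v\<close> passes the entries of \<open>xs\<close> one at a time, each by an adjacent transposition. This is the
  source of the sign \<open>(- 1) ^ i\<close> in the simplicial boundary.
\<close>

lemma reordering_sign_move:
  "distinct (v # xs @ ys) \<Longrightarrow> reordering_sign (v # xs @ ys) (xs @ v # ys) = (- 1) ^ length xs"
proof (induction xs)
  case Nil
  then show ?case
    using reordering_sign_map[of "v # ys" id] by simp
next
  case (Cons w xs)
  have "reordering_sign (v # w # xs @ ys) (w # v # xs @ ys) * reordering_sign (w # v # xs @ ys) (w # xs @ v # ys)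
      = reordering_sign (v # w # xs @ ys) (w # xs @ v # ys)"
    using Cons.prems by (intro reordering_sign_trans) auto
  moreover have "reordering_sign (w # v # xs @ ys) (w # xs @ v # ys) = reordering_sign (v # xs @ ys) (xs @ v # ys)"
    using Cons.prems by (intro reordering_sign_Cons) auto
  ultimately show ?case
    using reordering_sign_swap[of v w "xs @ ys"] Cons by simp
qed

section \<open>Incidence numbers\<close>

definition incidence :: "('v set \<Rightarrow> 'v list) \<Rightarrow> 'v set \<Rightarrow> 'v set \<Rightarrow> int" where
  "incidence ori \<tau> \<rho> = Poly_Mapping.lookup (simplicial_boundary ori (frag_of \<tau>)) \<rho>"

lemma incidence_eq_sum:
  "incidence ori \<tau> \<rho> = (\<Sum>i<length (ori \<tau>). (- 1) ^ i *
     Poly_Mapping.lookup (oriented_simplex ori (take i (ori \<tau>) @ drop (Suc i) (ori \<tau>))) \<rho>)"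
  by (simp add: incidence_def simplicial_boundary_def lookup_sum)

lemma lookup_oriented_simplex:
  "Poly_Mapping.lookup (oriented_simplex ori xs) \<rho> =
     (if xs \<noteq> [] \<and> \<rho> = set xs then reordering_sign (ori (set xs)) xs else 0)"
  by (auto simp: oriented_simplex_def)

lemma distinct_set_omit_nth:
  assumes "distinct xs" "i < length xs"
  shows "set (take i xs @ drop (Suc i) xs) = set xs - {xs ! i}"
proof -
  define as x bs where "as = take i xs" and "x = xs ! i" and "bs = drop (Suc i) xs"
  have xs: "xs = as @ x # bs"
    unfolding as_def x_def bs_def by (rule id_take_nth_drop[OF assms(2)])
  with assms(1) have "distinct (as @ x # bs)"
    by simp
  then have "set (as @ bs) = set (as @ x # bs) - {x}"
    by auto
  then show ?thesis
    using xs unfolding as_def[symmetric] x_def[symmetric] bs_def[symmetric] by simp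
qed

locale oriented_complex =
  fixes K :: "'v set set" and ori :: "'v set \<Rightarrow> 'v list"
  assumes complex: "finite_simplicial_complex K" and orient: "orientation K ori"
begin

abbreviation inc :: "'v set \<Rightarrow> 'v set \<Rightarrow> int" where "inc \<equiv> incidence ori"

lemma finite_simplex: "\<tau> \<in> K \<Longrightarrow> finite \<tau>"
  and simplex_nonempty: "\<tau> \<in> K \<Longrightarrow> \<tau> \<noteq> {}"
  and face_closed: "\<lbrakk>\<tau> \<in> K; \<rho> \<noteq> {}; \<rho> \<subseteq> \<tau>\<rbrakk> \<Longrightarrow> \<rho> \<in> K"
  and finite_K: "finite K"
  using complex unfolding finite_simplicial_complex_def by blast+

lemma distinct_ori: "\<tau> \<in> K \<Longrightarrow> distinct (ori \<tau>)" and set_ori: "\<tau> \<in> K \<Longrightarrow> set (ori \<tau>) = \<tau>"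
  using orient by (auto simp: orientation_def)

lemma incidence_nonzeroE:
  assumes "inc \<tau> \<rho> \<noteq> 0" and "\<tau> \<in> K"
  obtains v where "v \<in> \<tau>" "\<rho> = \<tau> - {v}" "\<rho> \<noteq> {}"
proof -
  obtain i where i: "i < length (ori \<tau>)"
    "Poly_Mapping.lookup (oriented_simplex ori (take i (ori \<tau>) @ drop (Suc i) (ori \<tau>))) \<rho> \<noteq> 0"
    using assms(1) unfolding incidence_eq_sum by (auto elim!: sum.not_neutral_contains_not_neutral)
  let ?xs = "take i (ori \<tau>) @ drop (Suc i) (ori \<tau>)"
  have "?xs \<noteq> []" and \<rho>: "\<rho> = set ?xs"
    using i(2) unfolding lookup_oriented_simplex by presburger+
  then have "\<rho> \<noteq> {}" by (metis set_empty)
  moreover have "\<rho> = \<tau> - {ori \<tau> ! i}"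
    using \<rho> distinct_set_omit_nth[OF distinct_ori i(1)] assms(2) set_ori by simp
  moreover have "ori \<tau> ! i \<in> \<tau>"
    using i(1) assms(2) set_ori nth_mem by blast
  ultimately show thesis using that by blast
qed

text \<open>
  An incidence number can be read off any ordering of the larger simplex that starts with the removed
  vertex, provided both simplices are compared with their chosen orderings: moving the removed vertex to
  the front absorbs the sign \<open>(- 1) ^ i\<close>, and what remains is a comparison of orderings of the face.
  Squares and products of incidence numbers are computed from this formula, without a return to
  permutations.
\<close>

lemma incidence_remove_hd:
  assumes "distinct (v # xs)" and "set (v # xs) \<in> K" and "xs \<noteq> []"
  shows "reordering_sign (ori (set (v # xs))) (v # xs) * inc (set (v # xs)) (set xs)
       = reordering_sign (ori (set xs)) xs"
proof -
  define \<tau> where "\<tau> = set (v # xs)"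
  have \<tau>: "\<tau> \<in> K" and xsK: "set xs \<in> K"
    using assms face_closed[OF assms(2), of "set xs"] by (auto simp: \<tau>_def)
  have v: "v \<in> set (ori \<tau>)"
    using \<tau> set_ori by (simp add: \<tau>_def)
  then obtain as bs where ab: "ori \<tau> = as @ v # bs"
    by (meson split_list)
  have dist: "distinct (as @ v # bs)"
    using distinct_ori[OF \<tau>] ab by simp
  have setab: "set (as @ bs) = set xs"
    using set_ori[OF \<tau>] dist assms(1) unfolding ab by (auto simp: \<tau>_def)
  then have abne: "as @ bs \<noteq> []"
    using assms(3) by auto
  have zero: "Poly_Mapping.lookup (oriented_simplex ori (take i (ori \<tau>) @ drop (Suc i) (ori \<tau>))) (set xs) = 0"
    if "i < length (ori \<tau>)" "i \<noteq> length as" for i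
  proof -
    have "ori \<tau> ! i \<noteq> v"
      using that distinct_ori[OF \<tau>] ab nth_eq_iff_index_eq[of "ori \<tau>" i "length as"] by auto
    then have "v \<in> set (take i (ori \<tau>) @ drop (Suc i) (ori \<tau>))"
      using distinct_set_omit_nth[OF distinct_ori[OF \<tau>] that(1)] v by simp
    then have "set xs \<noteq> set (take i (ori \<tau>) @ drop (Suc i) (ori \<tau>))"
      using assms(1) by auto
    then show ?thesis
      unfolding lookup_oriented_simplex by (simp only: simp_thms if_False)
  qed
  have "inc \<tau> (set xs) = (\<Sum>i\<in>{length as}. (- 1) ^ i *
     Poly_Mapping.lookup (oriented_simplex ori (take i (ori \<tau>) @ drop (Suc i) (ori \<tau>))) (set xs))"
    unfolding incidence_eq_sum by (rule sum.mono_neutral_right) (use zero ab in auto)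
  also have "\<dots> = (- 1) ^ length as * reordering_sign (ori (set xs)) (as @ bs)"
    using abne setab by (simp add: ab lookup_oriented_simplex)
  finally have inc: "inc \<tau> (set xs) = (- 1) ^ length as * reordering_sign (ori (set xs)) (as @ bs)" .
  define e X Y where "e = (- 1 :: int) ^ length as" and "X = reordering_sign (ori \<tau>) (v # xs)"
    and "Y = reordering_sign (ori (set xs)) (as @ bs)"
  have "reordering_sign (v # as @ bs) (as @ v # bs) * reordering_sign (as @ v # bs) (v # xs)
      = reordering_sign (v # as @ bs) (v # xs)"
    using dist assms(1) setab by (intro reordering_sign_trans) auto
  also have "reordering_sign (v # as @ bs) (as @ v # bs) = e"
    unfolding e_def using dist by (intro reordering_sign_move) auto
  also have "reordering_sign (v # as @ bs) (v # xs) = reordering_sign (as @ bs) xs"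
    using dist assms(1) setab by (intro reordering_sign_Cons) auto
  finally have eX: "e * X = reordering_sign (as @ bs) xs"
    unfolding X_def ab .
  have "X * inc \<tau> (set xs) = Y * (e * X)"
    unfolding inc e_def[symmetric] Y_def[symmetric] by (simp only: mult_ac)
  also have "\<dots> = reordering_sign (ori (set xs)) xs"
    unfolding eX Y_def using dist assms(1) setab distinct_ori[OF xsK] set_ori[OF xsK]
    by (intro reordering_sign_trans) auto
  finally show ?thesis
    unfolding X_def \<tau>_def .
qed

lemma incidence_square:
  assumes "\<tau> \<in> K" and "v \<in> \<tau>" and "\<tau> - {v} \<noteq> {}"
  shows "inc \<tau> (\<tau> - {v}) * inc \<tau> (\<tau> - {v}) = 1"
proof -
  obtain xs where xs: "distinct xs" "set xs = \<tau> - {v}"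
    using finite_distinct_list[OF finite_Diff[OF finite_simplex[OF assms(1)]]] by meson
  have \<tau>: "set (v # xs) = \<tau>"
    using xs assms by auto
  have ne: "xs \<noteq> []" using xs assms by force
  define s t where "s = reordering_sign (ori \<tau>) (v # xs)" and "t = reordering_sign (ori (\<tau> - {v})) xs"
  have "s * inc \<tau> (\<tau> - {v}) = t"
    using incidence_remove_hd[of v xs] xs \<tau> ne assms by (simp add: s_def t_def insert_absorb)
  moreover have "s * s = 1" "t * t = 1"
    by (simp_all add: s_def t_def reordering_sign_square)
  moreover have "t * t = (s * s) * (inc \<tau> (\<tau> - {v}) * inc \<tau> (\<tau> - {v}))"
    unfolding calculation(1)[symmetric] by (simp only: mult_ac)
  ultimately show ?thesis
    by simp
qed

text \<open>
  Removing two vertices in the two possible orders compares the orderings \<open>v # w # xs\<close> and \<open>w # v # xs\<close>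
  of the big simplex with the same ordering \<open>xs\<close> of the small one, and these two differ by a transposition.
\<close>

lemma incidence_anticommute:
  assumes "\<rho> \<in> K" "v \<noteq> w" "v \<notin> \<rho>" "w \<notin> \<rho>" "insert v (insert w \<rho>) \<in> K"
  shows "inc (insert v (insert w \<rho>)) (insert v \<rho>) * inc (insert v \<rho>) \<rho> =
       - (inc (insert v (insert w \<rho>)) (insert w \<rho>) * inc (insert w \<rho>) \<rho>)"
proof -
  obtain xs where xs: "distinct xs" "set xs = \<rho>"
    using finite_distinct_list[OF finite_simplex[OF assms(1)]] by blast
  have ne: "xs \<noteq> []" using xs assms(1) simplex_nonempty by force
  define \<tau> where "\<tau> = insert v (insert w \<rho>)"
  have \<tau>: "\<tau> \<in> K" "insert w (insert v \<rho>) = \<tau>" "insert v (insert w \<rho>) = \<tau>" using assms \<tau>_def by auto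
  have K: "insert v \<rho> \<in> K" "insert w \<rho> \<in> K"
    by (rule face_closed[OF \<tau>(1)]; auto simp: \<tau>_def)+
  let ?r = "\<lambda>xs. reordering_sign (ori (set xs)) xs"
  define s s' t where "s = ?r (v # w # xs)" and "s' = ?r (w # v # xs)" and "t = ?r xs"
  have "s * inc \<tau> (insert w \<rho>) = ?r (w # xs)" "s' * inc \<tau> (insert v \<rho>) = ?r (v # xs)"
    using incidence_remove_hd[of v "w # xs"] incidence_remove_hd[of w "v # xs"] xs assms \<tau>
    by (auto simp: s_def s'_def)
  moreover have "?r (w # xs) * inc (insert w \<rho>) \<rho> = t" "?r (v # xs) * inc (insert v \<rho>) \<rho> = t"
    using incidence_remove_hd[of v "xs"] incidence_remove_hd[of w "xs"] xs assms K ne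
    by (auto simp: t_def)
  ultimately have 1: "s * (inc \<tau> (insert w \<rho>) * inc (insert w \<rho>) \<rho>) = t"
    "s' * (inc \<tau> (insert v \<rho>) * inc (insert v \<rho>) \<rho>) = t"
    by (metis mult.assoc)+
  have "s * reordering_sign (v # w # xs) (w # v # xs) = s'"
    unfolding s_def s'_def using xs assms \<tau> distinct_ori[OF \<tau>(1)] set_ori[OF \<tau>(1)]
    by (simp only: list.set \<tau>, intro reordering_sign_trans) auto
  then have "s' = - s"
    using reordering_sign_swap[of v w xs] xs assms by auto
  have "s * s = 1"
    by (simp add: s_def reordering_sign_square)
  then have "s \<noteq> 0"
    by auto
  moreover have "s * (inc \<tau> (insert v \<rho>) * inc (insert v \<rho>) \<rho> +
      inc \<tau> (insert w \<rho>) * inc (insert w \<rho>) \<rho>) = 0"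
    using 1 \<open>s' = - s\<close> by (simp add: distrib_left)
  ultimately have "inc \<tau> (insert v \<rho>) * inc (insert v \<rho>) \<rho> +
      inc \<tau> (insert w \<rho>) * inc (insert w \<rho>) \<rho> = 0"
    by (simp only: mult_eq_0_iff simp_thms)
  then show ?thesis
    unfolding \<tau>_def by simp
qed

lemma incidence_face:
  assumes "inc \<tau> \<rho> \<noteq> 0" "\<tau> \<in> K"
  shows "\<rho> \<subseteq> \<tau>" "card \<tau> = Suc (card \<rho>)" "\<rho> \<in> K"
proof -
  obtain v where v: "v \<in> \<tau>" "\<rho> = \<tau> - {v}" "\<rho> \<noteq> {}"
    by (rule incidence_nonzeroE[OF assms])
  show "\<rho> \<subseteq> \<tau>"
    using v by auto
  then show "\<rho> \<in> K"
    using face_closed[OF assms(2) v(3)] by simp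
  show "card \<tau> = Suc (card \<rho>)"
    using v finite_simplex[OF assms(2)] card.remove by metis
qed

text \<open>
  This is \<open>\<partial>\<partial> = 0\<close>, written with incidence numbers: only faces of codimension two matter, and for them
  the sum has exactly the two terms that cancel because the two removals anticommute.
\<close>

lemma sum_incidence_incidence:
  assumes "\<rho> \<in> K" "\<tau> \<in> K"
  shows "(\<Sum>y\<in>{\<rho>..\<tau>}. inc \<tau> y * inc y \<rho>) = 0"
proof (cases "\<exists>y\<in>{\<rho>..\<tau>}. inc \<tau> y * inc y \<rho> \<noteq> 0")
  case True
  then obtain y where y: "\<rho> \<subseteq> y" "y \<subseteq> \<tau>" "inc \<tau> y \<noteq> 0" "inc y \<rho> \<noteq> 0"
    by auto
  have "y \<in> K" by (rule incidence_face(3)[OF y(3) assms(2)])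
  obtain v where v: "v \<in> \<tau>" "y = \<tau> - {v}"
    by (rule incidence_nonzeroE[OF y(3) assms(2)])
  obtain w where w: "w \<in> y" "\<rho> = y - {w}"
    by (rule incidence_nonzeroE[OF y(4) \<open>y \<in> K\<close>])
  note vw = v w
  then have vw': "v \<noteq> w" "v \<notin> \<rho>" "w \<notin> \<rho>" and \<tau>: "\<tau> = insert v (insert w \<rho>)" by auto
  have fin: "finite {\<rho>..\<tau>}"
    by (rule finite_subset[of _ "Pow \<tau>"]) (use finite_simplex[OF assms(2)] in auto)
  have zero: "inc \<tau> z * inc z \<rho> = 0" if "z \<in> {\<rho>..\<tau>} - {insert v \<rho>, insert w \<rho>}" for z
  proof (rule ccontr)
    assume *: "inc \<tau> z * inc z \<rho> \<noteq> 0"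
    then have nz: "inc \<tau> z \<noteq> 0" "inc z \<rho> \<noteq> 0" by auto
    have "z \<in> K" by (rule incidence_face(3)[OF nz(1) assms(2)])
    obtain b where b: "b \<in> z" "\<rho> = z - {b}"
      by (rule incidence_nonzeroE[OF nz(2) \<open>z \<in> K\<close>])
    have "z = insert b \<rho>" and "b \<notin> \<rho>"
      using b by blast+
    moreover have "b \<in> \<tau>"
      using b(1) incidence_face(1)[OF nz(1) assms(2)] by blast
    ultimately have "z \<in> {insert v \<rho>, insert w \<rho>}"
      unfolding \<tau> by blast
    then show False
      using that by blast
  qed
  have "(\<Sum>y\<in>{\<rho>..\<tau>}. inc \<tau> y * inc y \<rho>) = (\<Sum>y\<in>{insert v \<rho>, insert w \<rho>}. inc \<tau> y * inc y \<rho>)"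
  proof (rule sum.mono_neutral_right[OF fin])
    show "{insert v \<rho>, insert w \<rho>} \<subseteq> {\<rho>..\<tau>}"
      unfolding \<tau> by auto
  qed (use zero in blast)
  also have "\<dots> = inc \<tau> (insert v \<rho>) * inc (insert v \<rho>) \<rho> + inc \<tau> (insert w \<rho>) * inc (insert w \<rho>) \<rho>"
    using vw' by (subst sum.insert) (auto simp: insert_eq_iff)
  also have "\<dots> = 0"
    using incidence_anticommute[OF assms(1) vw'] assms(2) unfolding \<tau> by simp
  finally show ?thesis .
next
  case False
  then show ?thesis
    by (intro sum.neutral) blast
qed

end


section \<open>Linear algebra in free abelian groups\<close>

text \<open>
  In the simplicial complexes each simplex is its own location, so a component is just a coefficient.
\<close>

lemma part_at_eq:
  assumes "loc M = (\<lambda>b. b)"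
  shows "part_at M x u = frag_cmul (Poly_Mapping.lookup u x) (frag_of x)"
proof (cases "x \<in> Poly_Mapping.keys u")
  case True
  have "part_at M x u = (\<Sum>i\<in>Poly_Mapping.keys u. if i = x then frag_cmul (Poly_Mapping.lookup u x) (frag_of x) else 0)"
    unfolding part_at_def frag_extend_def by (intro sum.cong) (auto simp: assms)
  then show ?thesis
    using True by simp
next
  case False
  then show ?thesis
    unfolding part_at_def by (subst frag_extend_eq_0) (auto simp: assms in_keys_iff)
qed

lemma frag_tensor_cmul_of:
  "frag_tensor (frag_cmul p (frag_of a)) (frag_cmul q (frag_of b)) = frag_cmul (p * q) (frag_of (a, b))"
  by (simp add: frag_tensor_def frag_extend_cmul)

lemma frag_cmul_diff: "frag_cmul k (u - v) = frag_cmul k u - frag_cmul k v"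
  by (rule poly_mapping_eqI) (simp add: lookup_minus right_diff_distrib)

lemma minus_one_pow_uminus: "minus_one_pow (- n) = minus_one_pow n"
  and minus_one_pow_one_minus: "minus_one_pow (1 - n) = - minus_one_pow n"
  and minus_one_pow_plus_one: "minus_one_pow (n + 1) = - minus_one_pow n"
  and minus_one_pow_square: "minus_one_pow n * minus_one_pow n = 1"
  by (auto simp: minus_one_pow_def)

lemma frag_cmul_sum_left: "(\<Sum>i\<in>I. frag_cmul (f i) u) = frag_cmul (\<Sum>i\<in>I. f i) u"
  by (induction I rule: infinite_finite_induct) (simp_all add: frag_cmul_distrib)

text \<open>
  Bounding the support on generators suffices for every additive map, in particular for combinations and
  composites of maps that are not literally of the form \<open>frag_extend f\<close>.
\<close>

lemma keys_additive_subset: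
  fixes \<Phi> :: "('a \<Rightarrow>\<^sub>0 int) \<Rightarrow> ('b \<Rightarrow>\<^sub>0 int)"
  assumes diff: "\<And>u v. \<Phi> (u - v) = \<Phi> u - \<Phi> v"
    and gen: "\<And>g. g \<in> Poly_Mapping.keys u \<Longrightarrow> Poly_Mapping.keys (\<Phi> (frag_of g)) \<subseteq> T"
  shows "Poly_Mapping.keys (\<Phi> u) \<subseteq> T"
proof (rule frag_induction[of u "Poly_Mapping.keys u" "\<lambda>u. Poly_Mapping.keys (\<Phi> u) \<subseteq> T"])
  show "Poly_Mapping.keys (\<Phi> 0) \<subseteq> T"
    using diff[of 0 0] by simp
  show "Poly_Mapping.keys (\<Phi> (x - y)) \<subseteq> T"
    if "Poly_Mapping.keys (\<Phi> x) \<subseteq> T" "Poly_Mapping.keys (\<Phi> y) \<subseteq> T" for x y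
    using that keys_diff[of "\<Phi> x" "\<Phi> y"] unfolding diff by blast
qed (use gen in auto)

lemma hom_free_Abelian_groupI:
  assumes "\<And>u. Poly_Mapping.keys u \<subseteq> S \<Longrightarrow> Poly_Mapping.keys (f u) \<subseteq> T"
    and "\<And>u v. f (u + v) = f u + f v"
  shows "f \<in> hom (free_Abelian_group S) (free_Abelian_group T)"
  using assms by (intro homI) auto


section \<open>The differential of the round tensor product\<close>

context oriented_complex begin

definition tensor_complex :: "('v set \<times> 'v set, 'v set \<times> 'v set) graded_complex" where
  "tensor_complex = round_tensor_complex (face_poset K) (simplicial_cochains K ori) (simplicial_chains K ori)"

abbreviation tensor_diff :: "('v set \<times> 'v set \<Rightarrow>\<^sub>0 int) \<Rightarrow> ('v set \<times> 'v set \<Rightarrow>\<^sub>0 int)" where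
  "tensor_diff \<equiv> diff tensor_complex"

abbreviation dim_sign :: "'v set \<Rightarrow> int" where
  "dim_sign a \<equiv> minus_one_pow (simplex_dim a)"

definition coface_sum :: "'v set \<Rightarrow> 'v set \<Rightarrow> ('v set \<times> 'v set \<Rightarrow>\<^sub>0 int)" where
  "coface_sum a b = (\<Sum>x\<in>{a..b}. frag_cmul (inc x a) (frag_of (x, b)))"

definition face_sum :: "'v set \<Rightarrow> 'v set \<Rightarrow> ('v set \<times> 'v set \<Rightarrow>\<^sub>0 int)" where
  "face_sum a b = (\<Sum>y\<in>{a..b}. frag_cmul (inc b y) (frag_of (a, y)))"

lemma interval_subset: "\<lbrakk>a \<in> K; b \<in> K; a \<subseteq> x; x \<subseteq> b\<rbrakk> \<Longrightarrow> x \<in> K"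
  using face_closed[of b x] simplex_nonempty[of a] by blast

lemma finite_interval: "b \<in> K \<Longrightarrow> finite {a..b}"
  by (rule finite_subset[of _ "Pow b"]) (use finite_simplex in auto)

lemma tensor_diff_frag_extend: "\<exists>f. tensor_diff = frag_extend f"
  by (auto simp: tensor_complex_def round_tensor_complex_def)

lemma tensor_diff_add: "tensor_diff (u + v) = tensor_diff u + tensor_diff v"
  and tensor_diff_subtract: "tensor_diff (u - v) = tensor_diff u - tensor_diff v"
  and tensor_diff_cmul: "tensor_diff (frag_cmul k u) = frag_cmul k (tensor_diff u)"
  and tensor_diff_sum: "finite I \<Longrightarrow> tensor_diff (\<Sum>i\<in>I. g i) = (\<Sum>i\<in>I. tensor_diff (g i))"
  and tensor_diff_0: "tensor_diff 0 = 0"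
  using tensor_diff_frag_extend
  by (auto simp: frag_extend_add frag_extend_diff frag_extend_cmul frag_extend_sum)

text \<open>
  For modules whose generators are their own locations, the components of a round tensor product of
  morphisms are products of matrix entries, restricted to pairs that lie in the given interval.
\<close>

lemma round_tensor_hom_frag_of:
  assumes locs: "loc M = (\<lambda>b. b)" "loc N = (\<lambda>b. b)" "loc M' = (\<lambda>b. b)" "loc N' = (\<lambda>b. b)"
  shows "round_tensor_hom (face_poset K) M N M' N' f g (frag_of (a, b)) =
    (\<Sum>(x, y)\<in>{(x, y). x \<in> K \<and> y \<in> K \<and> x \<subseteq> y \<and> a \<subseteq> x \<and> y \<subseteq> b}.
      frag_cmul (Poly_Mapping.lookup (f (frag_of a)) x * Poly_Mapping.lookup (g (frag_of b)) y) (frag_of (x, y)))"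
proof -
  have "{z \<in> carrier (D_poset (face_poset K)). z \<sqsubseteq>\<^bsub>D_poset (face_poset K)\<^esub> (a, b)} =
      {(x, y). x \<in> K \<and> y \<in> K \<and> x \<subseteq> y \<and> a \<subseteq> x \<and> y \<subseteq> b}"
    by (auto simp: D_poset_def face_poset_def)
  then show ?thesis
    by (simp add: round_tensor_hom_def locs part_at_eq[OF locs(3)] part_at_eq[OF locs(4)] frag_tensor_cmul_of)
qed

text \<open>
  Of all components of the differential at \<open>(a, b)\<close>, only those that keep one of the two simplices
  survive: the coboundary enlarges \<open>a\<close> inside \<open>b\<close>, the boundary shrinks \<open>b\<close> down to \<open>a\<close> at most. The
  relative sign between the two sums comes from the sign of the dual differential.
\<close>

lemma tensor_diff_frag_of:
  assumes "a \<in> K" "b \<in> K"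
  shows "tensor_diff (frag_of (a, b)) = frag_cmul (dim_sign a) (face_sum a b - coface_sum a b)"
proof -
  let ?I = "{(x, y). x \<in> K \<and> y \<in> K \<and> x \<subseteq> y \<and> a \<subseteq> x \<and> y \<subseteq> b}"
  let ?C = "simplicial_cochains K ori" and ?D = "simplicial_chains K ori"
  let ?h = "round_tensor_hom (face_poset K) ?C ?D ?C ?D"
  have fin: "finite ?I"
    by (rule finite_subset[of _ "K \<times> K"]) (use finite_K in auto)
  have locs: "loc ?C = (\<lambda>b. b)" "loc ?D = (\<lambda>b. b)"
    by (simp_all add: simplicial_cochains_def dual_complex_def simplicial_chains_def)
  have deg: "deg ?C a = - simplex_dim a"
    by (simp add: simplicial_cochains_def dual_complex_def simplicial_chains_def)
  have "?h (diff ?C) id (frag_of (a, b)) =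
      (\<Sum>(x, y)\<in>?I. frag_cmul (Poly_Mapping.lookup (diff ?C (frag_of a)) x *
        Poly_Mapping.lookup (frag_of b) y) (frag_of (x, y)))"
    by (simp add: round_tensor_hom_frag_of[OF locs locs])
  also have "\<dots> = (\<Sum>(x, y)\<in>(\<lambda>x. (x, b)) ` {a..b}. frag_cmul (Poly_Mapping.lookup (diff ?C (frag_of a)) x *
        Poly_Mapping.lookup (frag_of b) y) (frag_of (x, y)))"
  proof (rule sum.mono_neutral_right[OF fin])
    show "(\<lambda>x. (x, b)) ` {a..b} \<subseteq> ?I"
      using assms interval_subset[OF assms] by auto
  qed auto
  also have "\<dots> = (\<Sum>x\<in>{a..b}. frag_cmul (Poly_Mapping.lookup (diff ?C (frag_of a)) x) (frag_of (x, b)))"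
    by (subst sum.reindex) (auto simp: inj_on_def)
  also have "\<dots> = (\<Sum>x\<in>{a..b}. frag_cmul (- dim_sign a) (frag_cmul (inc x a) (frag_of (x, b))))"
  proof (rule sum.cong[OF refl])
    fix x assume "x \<in> {a..b}"
    then have "x \<in> K"
      using interval_subset[OF assms] by simp
    then show "frag_cmul (Poly_Mapping.lookup (diff ?C (frag_of a)) x) (frag_of (x, b)) =
        frag_cmul (- dim_sign a) (frag_cmul (inc x a) (frag_of (x, b)))"
      using lookup_diff_simplicial_cochains[OF finite_K, of x ori a]
      unfolding incidence_def by (simp add: minus_one_pow_one_minus)
  qed
  also have "\<dots> = frag_cmul (- dim_sign a) (coface_sum a b)"
    by (simp only: coface_sum_def frag_cmul_sum)
  finally have left: "?h (diff ?C) id (frag_of (a, b)) = frag_cmul (- dim_sign a) (coface_sum a b)" .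
  have "?h id (diff ?D) (frag_of (a, b)) =
      (\<Sum>(x, y)\<in>?I. frag_cmul (Poly_Mapping.lookup (frag_of a) x * inc b y) (frag_of (x, y)))"
    unfolding round_tensor_hom_frag_of[OF locs locs] incidence_def by (simp add: simplicial_chains_def)
  also have "\<dots> = (\<Sum>(x, y)\<in>(\<lambda>y. (a, y)) ` {a..b}. frag_cmul (Poly_Mapping.lookup (frag_of a) x * inc b y) (frag_of (x, y)))"
  proof (rule sum.mono_neutral_right[OF fin])
    show "(\<lambda>y. (a, y)) ` {a..b} \<subseteq> ?I"
      using assms interval_subset[OF assms] by auto
  qed auto
  also have "\<dots> = face_sum a b"
    unfolding face_sum_def by (subst sum.reindex) (auto simp: inj_on_def)
  finally have right: "?h id (diff ?D) (frag_of (a, b)) = face_sum a b" .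
  have "tensor_diff (frag_of (a, b)) = ?h (diff ?C) id (frag_of (a, b)) +
      frag_cmul (minus_one_pow (deg ?C a)) (?h id (diff ?D) (frag_of (a, b)))"
    by (simp add: tensor_complex_def round_tensor_complex_def)
  also have "\<dots> = frag_cmul (dim_sign a) (face_sum a b) - frag_cmul (dim_sign a) (coface_sum a b)"
    unfolding left right deg minus_one_pow_uminus by simp
  also have "\<dots> = frag_cmul (dim_sign a) (face_sum a b - coface_sum a b)"
    by (simp add: frag_cmul_diff)
  finally show ?thesis .
qed

text \<open>
  The sign alternates along every face relation; stated with the incidence number as a factor, this holds
  for all pairs.
\<close>

lemma dim_sign_incidence:
  assumes "x \<in> K"
  shows "inc x a * dim_sign x = - (dim_sign a * inc x a)"
proof (cases "inc x a = 0")
  case False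
  then have "simplex_dim x = simplex_dim a + 1"
    using incidence_face(2)[OF _ assms] by (simp add: simplex_dim_def)
  then show ?thesis
    by (simp add: minus_one_pow_plus_one)
qed auto

lemma sum_interval_swap:
  assumes "b \<in> K"
  shows "(\<Sum>y\<in>{a..b}. \<Sum>x\<in>{a..y}. g x y) = (\<Sum>x\<in>{a..b}. \<Sum>y\<in>{x..b}. g x y)"
proof -
  have "{x \<in> {a..b}. x \<subseteq> y} = {a..y}" if "y \<in> {a..b}" for y
    using that by (simp add: set_eq_iff) (meson order_trans)
  moreover have "{y \<in> {a..b}. x \<subseteq> y} = {x..b}" if "x \<in> {a..b}" for x
    using that by (simp add: set_eq_iff) (meson order_trans)
  ultimately show ?thesis
    using sum.swap_restrict[of "{a..b}" "{a..b}" "\<lambda>y x. g x y" "\<lambda>y x. x \<subseteq> y"] finite_interval[OF assms]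
    by simp
qed

lemma sum_face_face:
  assumes "a \<in> K" "b \<in> K"
  shows "(\<Sum>y\<in>{a..b}. frag_cmul (inc b y) (face_sum a y)) = 0"
proof -
  have "(\<Sum>y\<in>{a..b}. frag_cmul (inc b y) (face_sum a y)) =
      (\<Sum>y\<in>{a..b}. \<Sum>z\<in>{a..y}. frag_cmul (inc b y * inc y z) (frag_of (a, z)))"
    by (simp add: face_sum_def frag_cmul_sum)
  also have "\<dots> = (\<Sum>z\<in>{a..b}. frag_cmul (\<Sum>y\<in>{z..b}. inc b y * inc y z) (frag_of (a, z)))"
    unfolding sum_interval_swap[OF assms(2)] frag_cmul_sum_left ..
  also have "\<dots> = 0"
    using interval_subset[OF assms] by (intro sum.neutral) (simp add: sum_incidence_incidence assms)
  finally show ?thesis .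
qed

lemma sum_coface_coface:
  assumes "a \<in> K" "b \<in> K"
  shows "(\<Sum>x\<in>{a..b}. frag_cmul (inc x a) (coface_sum x b)) = 0"
proof -
  have "(\<Sum>x\<in>{a..b}. frag_cmul (inc x a) (coface_sum x b)) =
      (\<Sum>x\<in>{a..b}. \<Sum>z\<in>{x..b}. frag_cmul (inc z x * inc x a) (frag_of (z, b)))"
    by (simp add: coface_sum_def frag_cmul_sum mult.commute)
  also have "\<dots> = (\<Sum>z\<in>{a..b}. frag_cmul (\<Sum>x\<in>{a..z}. inc z x * inc x a) (frag_of (z, b)))"
    unfolding sum_interval_swap[OF assms(2), symmetric] frag_cmul_sum_left ..
  also have "\<dots> = 0"
    using interval_subset[OF assms] by (intro sum.neutral) (simp add: sum_incidence_incidence assms)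
  finally show ?thesis .
qed

text \<open>
  Enlarging the first simplex commutes with shrinking the second one, since both orders run over the
  chains \<open>a \<subseteq> x \<subseteq> y \<subseteq> b\<close>.
\<close>

lemma sum_coface_face:
  assumes "b \<in> K"
  shows "(\<Sum>y\<in>{a..b}. frag_cmul (inc b y) (coface_sum a y)) = (\<Sum>x\<in>{a..b}. frag_cmul (inc x a) (face_sum x b))"
  unfolding coface_sum_def face_sum_def frag_cmul_sum frag_cmul_cmul sum_interval_swap[OF assms]
  by (simp only: mult.commute)

lemma tensor_diff_tensor_diff_frag_of:
  assumes "a \<in> K" "b \<in> K"
  shows "tensor_diff (tensor_diff (frag_of (a, b))) = 0"
proof -
  let ?S = "\<Sum>y\<in>{a..b}. frag_cmul (inc b y) (coface_sum a y)"
  have "tensor_diff (face_sum a b) = (\<Sum>y\<in>{a..b}. frag_cmul (inc b y) (tensor_diff (frag_of (a, y))))"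
    unfolding face_sum_def by (simp add: tensor_diff_sum finite_interval assms tensor_diff_cmul)
  also have "\<dots> = (\<Sum>y\<in>{a..b}. frag_cmul (dim_sign a) (frag_cmul (inc b y) (face_sum a y)) -
      frag_cmul (dim_sign a) (frag_cmul (inc b y) (coface_sum a y)))"
    using interval_subset[OF assms]
    by (intro sum.cong) (simp_all add: tensor_diff_frag_of assms frag_cmul_diff mult.commute)
  also have "\<dots> = - frag_cmul (dim_sign a) ?S"
    unfolding sum_subtractf frag_cmul_sum[symmetric] sum_face_face[OF assms] by simp
  finally have face: "tensor_diff (face_sum a b) = - frag_cmul (dim_sign a) ?S" .
  have "tensor_diff (coface_sum a b) = (\<Sum>x\<in>{a..b}. frag_cmul (inc x a) (tensor_diff (frag_of (x, b))))"
    unfolding coface_sum_def by (simp add: tensor_diff_sum finite_interval assms tensor_diff_cmul)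
  also have "\<dots> = (\<Sum>x\<in>{a..b}. frag_cmul (- dim_sign a) (frag_cmul (inc x a) (face_sum x b)) -
      frag_cmul (- dim_sign a) (frag_cmul (inc x a) (coface_sum x b)))"
    using interval_subset[OF assms]
    by (intro sum.cong) (simp_all add: tensor_diff_frag_of assms frag_cmul_diff dim_sign_incidence)
  also have "\<dots> = - frag_cmul (dim_sign a) ?S"
    unfolding sum_subtractf frag_cmul_sum[symmetric] sum_coface_coface[OF assms] sum_coface_face[OF assms(2)] by simp
  finally have coface: "tensor_diff (coface_sum a b) = - frag_cmul (dim_sign a) ?S" .
  show ?thesis
    by (simp add: tensor_diff_frag_of[OF assms] tensor_diff_cmul tensor_diff_subtract face coface)
qed


subsection \<open>Contracting the columns\<close>

text \<open>
  The column over \<open>b\<close> consists of the generators \<open>(a, b)\<close> with \<open>s \<subseteq> a \<subseteq> b\<close> and the coboundary in the first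
  simplex. It is the augmented cochain complex of the simplex on the vertices \<open>b - s\<close>, which is a cone as
  soon as \<open>b \<noteq> s\<close>; the vertex below serves as its cone point.
\<close>

definition apex :: "'v set \<Rightarrow> 'v set \<Rightarrow> 'v" where
  "apex s b = (SOME v. v \<in> b - s)"

text \<open>
  Deleting the cone point, with the sign that inverts the incidence number. The cone point depends on \<open>b\<close>,
  so this contracts each column, but it does not respect the boundary in \<open>b\<close>. Testing membership in
  \<open>a - s\<close> rather than in \<open>a\<close> makes the operator vanish at \<open>(s, s)\<close>, where there is no cone point to choose.
\<close>

definition contraction :: "'v set \<Rightarrow> ('v set \<times> 'v set \<Rightarrow>\<^sub>0 int) \<Rightarrow> ('v set \<times> 'v set \<Rightarrow>\<^sub>0 int)" where
  "contraction s = frag_extend (\<lambda>(a, b). if apex s b \<in> a - s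
     then frag_cmul (dim_sign a * inc a (a - {apex s b})) (frag_of (a - {apex s b}, b)) else 0)"

lemma apex_in: "\<lbrakk>s \<subseteq> b; b \<noteq> s\<rbrakk> \<Longrightarrow> apex s b \<in> b - s"
  unfolding apex_def by (rule someI_ex) blast

lemma incidence_insert:
  assumes "c \<in> K" "insert v c \<in> K" "v \<notin> c"
  shows "inc (insert v c) c * inc (insert v c) c = 1"
  using incidence_square[of "insert v c" v] assms simplex_nonempty by simp

lemma incidence_upper_faceE:
  assumes "inc x c \<noteq> 0" "x \<in> K"
  obtains w where "w \<notin> c" "x = insert w c"
  using assms by (rule incidence_nonzeroE) blast

text \<open>
  Anticommutativity compares the two paths from \<open>insert v z\<close> down to \<open>c\<close>. Because incidence numbers of
  facets are their own inverses, it can be turned into a comparison of the two paths from \<open>z\<close> to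
  \<open>insert v c\<close>, through \<open>c\<close> and through \<open>insert v z\<close>. In this form it gives the cancellation in the
  contracting homotopy. If \<open>z\<close> does not arise from \<open>c\<close> by adding one vertex, both products vanish.
\<close>

lemma incidence_product_insert:
  assumes "c \<in> K" "insert v z \<in> K" "c \<subseteq> z" "v \<notin> z"
  shows "inc (insert v c) c * inc z c + inc (insert v z) (insert v c) * inc (insert v z) z = 0"
proof (cases "\<exists>w. w \<notin> c \<and> z = insert w c")
  case True
  then obtain w where w: "w \<notin> c" "z = insert w c" by blast
  have K: "insert v c \<in> K" "z \<in> K"
    using interval_subset[OF assms(1,2)] w by auto
  have "v \<noteq> w" "v \<notin> c"
    using assms w by auto
  define p q r t where "p = inc (insert v z) (insert v c)" and "q = inc (insert v c) c"
    and "r = inc (insert v z) z" and "t = inc z c"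
  have pq: "p * q = - (r * t)"
    using incidence_anticommute[OF assms(1) \<open>v \<noteq> w\<close> \<open>v \<notin> c\<close> w(1)] assms(2)
    unfolding p_def q_def r_def t_def w(2) by simp
  have rr: "r * r = 1" and qq: "q * q = 1"
    using incidence_insert[OF K(2) assms(2,4)] incidence_insert[OF assms(1) K(1) \<open>v \<notin> c\<close>]
    by (simp_all add: q_def r_def)
  have "p * r = (p * q) * (q * r)"
    using qq by (metis mult.assoc mult.right_neutral)
  also have "\<dots> = - (q * t) * (r * r)"
    unfolding pq by (simp only: mult_minus_left mult_minus_right mult_ac)
  finally show ?thesis
    unfolding rr by (simp add: p_def q_def r_def t_def)
next
  case False
  have z: "z \<in> K"
    using interval_subset[OF assms(1,2,3)] by auto
  have "inc z c = 0"
    using False incidence_upper_faceE[OF _ z] by blast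
  moreover have "inc (insert v z) (insert v c) = 0"
  proof (rule ccontr)
    assume "inc (insert v z) (insert v c) \<noteq> 0"
    then obtain w where w: "w \<notin> insert v c" "insert v z = insert w (insert v c)"
      using assms(2) by (rule incidence_upper_faceE)
    have "v \<notin> c"
      using assms(3,4) by blast
    moreover have "v \<notin> insert w c"
      using w(1) \<open>v \<notin> c\<close> by auto
    moreover have "insert v z = insert v (insert w c)"
      unfolding w(2) by (rule insert_commute)
    ultimately have "z = insert w c"
      using insert_ident[of v z "insert w c"] assms(4) by simp
    then show False
      using False w(1) by blast
  qed
  ultimately show ?thesis
    by simp
qed

text \<open>
  The factor \<open>dim_sign\<close> in the contraction is there to cancel the one in the differential, so that only
  incidence numbers are left.
\<close>

lemma contraction_coface_sum:
  assumes "a \<in> K" "b \<in> K"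
  shows "frag_cmul (- dim_sign a) (contraction s (coface_sum a b)) =
    (\<Sum>x\<in>{a..b}. if apex s b \<in> x - s then
      frag_cmul (inc x a * inc x (x - {apex s b})) (frag_of (x - {apex s b}, b)) else 0)"
proof -
  have "frag_cmul (- dim_sign a) (contraction s (coface_sum a b)) =
      (\<Sum>x\<in>{a..b}. frag_cmul (- dim_sign a) (frag_cmul (inc x a) (contraction s (frag_of (x, b)))))"
    unfolding contraction_def coface_sum_def frag_extend_sum[OF finite_interval[OF assms(2)]] frag_cmul_sum
    by (simp add: frag_extend_cmul)
  also have "\<dots> = (\<Sum>x\<in>{a..b}. if apex s b \<in> x - s then
      frag_cmul (inc x a * inc x (x - {apex s b})) (frag_of (x - {apex s b}, b)) else 0)"
  proof (rule sum.cong[OF refl])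
    fix x assume "x \<in> {a..b}"
    then have "x \<in> K"
      using interval_subset[OF assms] by simp
    have "- dim_sign a * (inc x a * dim_sign x) = (dim_sign a * dim_sign a) * inc x a"
      unfolding dim_sign_incidence[OF \<open>x \<in> K\<close>] by simp
    then have "- dim_sign a * (inc x a * dim_sign x) = inc x a"
      unfolding minus_one_pow_square by simp
    then have "- dim_sign a * (inc x a * (dim_sign x * k)) = inc x a * k" for k
      by (metis mult.assoc)
    then show "frag_cmul (- dim_sign a) (frag_cmul (inc x a) (contraction s (frag_of (x, b)))) =
        (if apex s b \<in> x - s then
          frag_cmul (inc x a * inc x (x - {apex s b})) (frag_of (x - {apex s b}, b)) else 0)"
      by (simp add: contraction_def mult.assoc)
  qed
  finally show ?thesis .
qed

text \<open>
  The homotopy identity within one column. If \<open>a\<close> misses the cone point \<open>v\<close>, then among the cofaces of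
  \<open>a\<close> only \<open>insert v a\<close> contains \<open>v\<close>, and deleting \<open>v\<close> leads back to \<open>a\<close>. If \<open>a = insert v c\<close>, the cofaces
  of \<open>c\<close> are \<open>a\<close> itself, which gives the identity, and simplices without \<open>v\<close>; the latter cancel against
  the cofaces of \<open>a\<close> with \<open>v\<close> deleted.
\<close>

lemma column_contraction:
  assumes "s \<in> K" "b \<in> K" "s \<subseteq> a" "a \<subseteq> b" "b \<noteq> s"
  shows "(if apex s b \<in> a then frag_cmul (inc a (a - {apex s b})) (coface_sum (a - {apex s b}) b) else 0)
    + frag_cmul (- dim_sign a) (contraction s (coface_sum a b)) = frag_of (a, b)"
proof -
  define v where "v = apex s b"
  have v: "v \<in> b" "v \<notin> s"
    using apex_in[of s b] assms by (auto simp: v_def)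
  have aK: "a \<in> K"
    using interval_subset assms by blast
  define g where "g z = frag_cmul (inc (insert v z) a * inc (insert v z) z) (frag_of (z, b))" for z
  have W: "frag_cmul (- dim_sign a) (contraction s (coface_sum a b)) =
      (\<Sum>x\<in>{a..b}. if v \<in> x then g (x - {v}) else 0)"
    unfolding contraction_coface_sum[OF aK assms(2)] using v
    by (intro sum.cong) (auto simp: v_def[symmetric] g_def insert_absorb)
  show ?thesis
  proof (cases "v \<in> a")
    case False
    have "(\<Sum>x\<in>{a..b}. if v \<in> x then g (x - {v}) else 0) =
        (\<Sum>x\<in>{insert v a}. if v \<in> x then g (x - {v}) else 0)"
    proof (rule sum.mono_neutral_right[OF finite_interval[OF assms(2)]])
      show "{insert v a} \<subseteq> {a..b}"
        using v assms by auto
      show "\<forall>x\<in>{a..b} - {insert v a}. (if v \<in> x then g (x - {v}) else 0) = 0"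
      proof
        fix x assume x: "x \<in> {a..b} - {insert v a}"
        then have "x \<in> K"
          using interval_subset[OF aK assms(2)] by simp
        have "inc x a = 0" if "v \<in> x"
        proof (rule ccontr)
          assume "inc x a \<noteq> 0"
          then obtain w where "w \<notin> a" "x = insert w a"
            using \<open>x \<in> K\<close> by (rule incidence_upper_faceE)
          then show False
            using x that False by blast
        qed
        then show "(if v \<in> x then g (x - {v}) else 0) = 0"
          by (auto simp: g_def insert_absorb)
      qed
    qed
    also have "\<dots> = frag_of (a, b)"
    proof -
      have "insert v a \<in> K"
        by (rule interval_subset[OF aK assms(2)]) (use v assms in auto)
      then show ?thesis
        using incidence_insert[OF aK _ False] False by (simp add: g_def)
    qed
    finally show ?thesis
      unfolding W v_def[symmetric] using False by simp
  next
    case True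
    define c where "c = a - {v}"
    have c: "a = insert v c" "v \<notin> c" "c \<in> K" "c \<subseteq> b"
      using True v assms interval_subset[OF assms(1,2), of c] by (auto simp: c_def)
    have "(\<Sum>x\<in>{a..b}. if v \<in> x then g (x - {v}) else 0) = (\<Sum>x\<in>{a..b}. g (x - {v}))"
      using True by (intro sum.cong) auto
    also have "\<dots> = (\<Sum>z\<in>{z \<in> {c..b}. v \<notin> z}. g z)"
      by (rule sum.reindex_bij_witness[where i = "insert v" and j = "\<lambda>x. x - {v}"])
        (use c v in \<open>auto simp: insert_absorb\<close>)
    also have "\<dots> = (\<Sum>z\<in>{c..b}. if v \<notin> z then g z else 0)"
      by (rule sum.inter_filter[OF finite_interval[OF assms(2)]])
    finally have "frag_cmul (inc a c) (coface_sum c b) + (\<Sum>x\<in>{a..b}. if v \<in> x then g (x - {v}) else 0) =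
        (\<Sum>z\<in>{c..b}. frag_cmul (inc a c * inc z c) (frag_of (z, b)) + (if v \<notin> z then g z else 0))"
      by (simp add: coface_sum_def frag_cmul_sum sum.distrib)
    also have "\<dots> = (\<Sum>z\<in>{c..b}. if z = a then frag_of (a, b) else 0)"
    proof (rule sum.cong[OF refl])
      fix z assume "z \<in> {c..b}"
      then have z: "c \<subseteq> z" "z \<subseteq> b" "z \<in> K"
        using interval_subset[OF c(3) assms(2)] by auto
      show "frag_cmul (inc a c * inc z c) (frag_of (z, b)) + (if v \<notin> z then g z else 0) =
          (if z = a then frag_of (a, b) else 0)"
      proof (cases "v \<in> z")
        case False
        have "insert v z \<in> K"
          by (rule interval_subset[OF c(3) assms(2)]) (use z v in auto)
        then have "inc a c * inc z c + inc (insert v z) a * inc (insert v z) z = 0"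
          using incidence_product_insert[OF c(3) _ z(1) False] c(1) by simp
        then show ?thesis
          using False True by (auto simp: g_def frag_cmul_distrib[symmetric])
      next
        case vz: True
        have "inc z c = 0" if "z \<noteq> a"
        proof (rule ccontr)
          assume "inc z c \<noteq> 0"
          then obtain w where "w \<notin> c" "z = insert w c"
            using z(3) by (rule incidence_upper_faceE)
          then show False
            using vz that c by blast
        qed
        moreover have "inc a c * inc a c = 1"
          using incidence_insert[OF c(3) _ c(2)] aK c(1) by simp
        ultimately show ?thesis
          using vz by simp
      qed
    qed
    also have "\<dots> = frag_of (a, b)"
      using c assms(4) finite_interval[OF assms(2)] by auto
    finally show ?thesis
      unfolding W v_def[symmetric] c_def[symmetric] using True by simp
  qed
qed

lemma contraction_frag_of:
  "contraction s (frag_of (a, b)) = (if apex s b \<in> a - s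
     then frag_cmul (dim_sign a * inc a (a - {apex s b})) (frag_of (a - {apex s b}, b)) else 0)"
  by (simp add: contraction_def)

lemma contraction_subtract: "contraction s (u - v) = contraction s u - contraction s v"
  and contraction_cmul: "contraction s (frag_cmul k u) = frag_cmul k (contraction s u)"
  by (simp_all add: contraction_def frag_extend_diff frag_extend_cmul)

lemma keys_face_sum: "Poly_Mapping.keys (face_sum a b) \<subseteq> {(a, y) |y. y \<in> {a..b} \<and> inc b y \<noteq> 0}"
  unfolding face_sum_def by (rule order_trans[OF keys_sum]) auto

lemma keys_coface_sum: "Poly_Mapping.keys (coface_sum a b) \<subseteq> {(x, b) |x. x \<in> {a..b} \<and> inc x a \<noteq> 0}"
  unfolding coface_sum_def by (rule order_trans[OF keys_sum]) auto

lemma keys_contraction: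
  assumes "\<And>a b. (a, b) \<in> Poly_Mapping.keys u \<Longrightarrow> apex s b \<in> a - s \<Longrightarrow> (a - {apex s b}, b) \<in> T"
  shows "Poly_Mapping.keys (contraction s u) \<subseteq> T"
  unfolding contraction_def using assms
  by (intro order_trans[OF keys_frag_extend]) (auto split: if_split_asm)

text \<open>
  The columns form a filtration by \<open>card b\<close> whose quotients have the coboundary as their only differential.
  Hence, away from \<open>(s, s)\<close>, the column contraction is a contraction of the whole complex up to terms in
  smaller columns, and the defect measures these terms.
\<close>

definition homotopy_defect :: "'v set \<Rightarrow> ('v set \<times> 'v set \<Rightarrow>\<^sub>0 int) \<Rightarrow> ('v set \<times> 'v set \<Rightarrow>\<^sub>0 int)" where
  "homotopy_defect s u = u - tensor_diff (contraction s u) - contraction s (tensor_diff u)"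

lemma tensor_diff_bottom:
  assumes "s \<in> K"
  shows "tensor_diff (frag_of (s, s)) = 0"
proof -
  have "inc s s = 0"
    using incidence_face(2)[OF _ assms, of s] by auto
  then have "face_sum s s = 0" "coface_sum s s = 0"
    by (simp_all add: face_sum_def coface_sum_def)
  then show ?thesis
    by (simp add: tensor_diff_frag_of assms)
qed

lemma homotopy_defect_bottom:
  assumes "s \<in> K"
  shows "homotopy_defect s (frag_of (s, s)) = frag_of (s, s)"
  using assms by (simp add: homotopy_defect_def contraction_frag_of tensor_diff_bottom tensor_diff_0)
    (simp add: contraction_def)

text \<open>
  The coboundary part of the defect vanishes because each column is contracted. What is left comes from the
  boundary in \<open>b\<close>, before or after the contraction, and lies in columns over facets of \<open>b\<close>.
\<close>

lemma keys_homotopy_defect_frag_of: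
  assumes "s \<in> K" "b \<in> K" "s \<subseteq> a" "a \<subseteq> b" "b \<noteq> s"
  shows "Poly_Mapping.keys (homotopy_defect s (frag_of (a, b))) \<subseteq> {(a', b'). card b' < card b}"
proof -
  define v c where "v = apex s b" and "c = a - {v}"
  have v: "v \<in> b" "v \<notin> s"
    using apex_in[of s b] assms by (auto simp: v_def)
  have aK: "a \<in> K" and cK: "c \<in> K"
    using interval_subset[OF assms(1,2), of a] interval_subset[OF assms(1,2), of c] v assms by (auto simp: c_def)
  define r where "r = (if v \<in> a then frag_cmul (inc a c) (face_sum c b) else 0)"
  have DH: "tensor_diff (contraction s (frag_of (a, b))) =
      (if v \<in> a then frag_cmul (inc a c) (coface_sum c b) else 0) - r"
  proof (cases "v \<in> a")
    case True
    have "dim_sign a * (inc a c * dim_sign c) = (inc a c * dim_sign a) * dim_sign c"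
      by (simp only: mult_ac)
    also have "\<dots> = - ((dim_sign c * dim_sign c) * inc a c)"
      unfolding dim_sign_incidence[OF aK] by (simp only: mult_minus_left mult_ac)
    finally have "dim_sign a * (inc a c * dim_sign c) = - inc a c"
      unfolding minus_one_pow_square by simp
    then show ?thesis
      using True v by (simp add: contraction_frag_of v_def[symmetric] c_def[symmetric] r_def tensor_diff_cmul
          tensor_diff_frag_of cK assms(2) mult.assoc frag_cmul_diff
          flip: minus_frag_cmul)
  next
    case False
    then show ?thesis
      by (simp add: contraction_frag_of v_def[symmetric] r_def tensor_diff_0)
  qed
  have HD: "contraction s (tensor_diff (frag_of (a, b))) =
      frag_cmul (dim_sign a) (contraction s (face_sum a b)) + frag_cmul (- dim_sign a) (contraction s (coface_sum a b))"
    by (simp add: tensor_diff_frag_of aK assms(2) contraction_cmul contraction_subtract frag_cmul_diff)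
  have "homotopy_defect s (frag_of (a, b)) = r - frag_cmul (dim_sign a) (contraction s (face_sum a b))"
    using column_contraction[OF assms] unfolding homotopy_defect_def DH HD v_def[symmetric] c_def[symmetric]
    by (simp add: algebra_simps)
  moreover have "Poly_Mapping.keys r \<subseteq> {(a', b'). card b' < card b}"
  proof -
    have "Poly_Mapping.keys r \<subseteq> Poly_Mapping.keys (face_sum c b)"
      using keys_cmul by (auto simp: r_def)
    then show ?thesis
      using keys_face_sum[of c b] incidence_face(2)[OF _ assms(2)] by fastforce
  qed
  moreover have "Poly_Mapping.keys (frag_cmul (dim_sign a) (contraction s (face_sum a b))) \<subseteq> {(a', b'). card b' < card b}"
  proof (rule order_trans[OF keys_cmul], rule keys_contraction)
    fix x y assume "(x, y) \<in> Poly_Mapping.keys (face_sum a b)"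
    then have "card b = Suc (card y)"
      using keys_face_sum[of a b] incidence_face(2)[OF _ assms(2)] by blast
    then show "(x - {apex s y}, y) \<in> {(a', b'). card b' < card b}"
      by simp
  qed
  ultimately show ?thesis
    using keys_diff by fastforce
qed

definition cells :: "'v set \<Rightarrow> 'v set \<Rightarrow> int \<Rightarrow> ('v set \<times> 'v set) set" where
  "cells s t n = {(a, b). a \<in> K \<and> b \<in> K \<and> s \<subseteq> a \<and> a \<subseteq> b \<and> b \<subseteq> t \<and> simplex_dim b - simplex_dim a = n}"

lemma tensor_diff_cells:
  assumes "Poly_Mapping.keys u \<subseteq> cells s t n"
  shows "Poly_Mapping.keys (tensor_diff u) \<subseteq> cells s t (n - 1)"
proof (rule keys_additive_subset[where \<Phi> = tensor_diff])
  fix g assume "g \<in> Poly_Mapping.keys u"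
  then obtain a b where g: "g = (a, b)" and ab: "a \<in> K" "b \<in> K" "s \<subseteq> a" "a \<subseteq> b" "b \<subseteq> t"
    "simplex_dim b - simplex_dim a = n"
    using assms by (auto simp: cells_def)
  have "Poly_Mapping.keys (face_sum a b) \<subseteq> cells s t (n - 1)"
  proof (rule order_trans[OF keys_face_sum], safe)
    fix y assume y: "y \<in> {a..b}" "inc b y \<noteq> 0"
    then show "(a, y) \<in> cells s t (n - 1)"
      using ab incidence_face(2,3)[OF y(2) ab(2)] by (auto simp: cells_def simplex_dim_def)
  qed
  moreover have "Poly_Mapping.keys (coface_sum a b) \<subseteq> cells s t (n - 1)"
  proof (rule order_trans[OF keys_coface_sum], safe)
    fix x assume x: "x \<in> {a..b}" "inc x a \<noteq> 0"
    then have "x \<in> K"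
      using interval_subset[OF ab(1,2)] by simp
    then show "(x, b) \<in> cells s t (n - 1)"
      using ab x incidence_face(2)[OF x(2)] by (auto simp: cells_def simplex_dim_def)
  qed
  ultimately show "Poly_Mapping.keys (tensor_diff (frag_of g)) \<subseteq> cells s t (n - 1)"
    unfolding g tensor_diff_frag_of[OF ab(1,2)]
    using keys_diff[of "face_sum a b" "coface_sum a b"] keys_cmul by blast
qed (rule tensor_diff_subtract)

lemma contraction_cells:
  assumes "Poly_Mapping.keys u \<subseteq> cells s t n" "s \<in> K"
  shows "Poly_Mapping.keys (contraction s u) \<subseteq> cells s t (n + 1)"
proof (rule keys_contraction)
  fix a b assume "(a, b) \<in> Poly_Mapping.keys u" and v: "apex s b \<in> a - s"
  then have ab: "a \<in> K" "b \<in> K" "s \<subseteq> a" "a \<subseteq> b" "b \<subseteq> t" "simplex_dim b - simplex_dim a = n"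
    using assms by (auto simp: cells_def)
  define c where "c = a - {apex s b}"
  have c: "s \<subseteq> c" "c \<subseteq> a" "card a = Suc (card c)"
    using v ab(3) card.remove[OF finite_simplex[OF ab(1)], of "apex s b"] by (auto simp: c_def)
  then have "c \<in> K"
    using interval_subset[OF assms(2) ab(1)] by simp
  then have "(c, b) \<in> cells s t (n + 1)"
    using ab c by (auto simp: cells_def simplex_dim_def)
  then show "(a - {apex s b}, b) \<in> cells s t (n + 1)"
    unfolding c_def .
qed

lemma tensor_diff_tensor_diff:
  assumes "Poly_Mapping.keys u \<subseteq> cells s t n"
  shows "tensor_diff (tensor_diff u) = 0"
proof -
  have "Poly_Mapping.keys (tensor_diff (tensor_diff u)) \<subseteq> {}"
  proof (rule keys_additive_subset[where \<Phi> = "\<lambda>u. tensor_diff (tensor_diff u)"])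
    fix g assume "g \<in> Poly_Mapping.keys u"
    then obtain a b where "g = (a, b)" "a \<in> K" "b \<in> K"
      using assms by (auto simp: cells_def)
    then show "Poly_Mapping.keys (tensor_diff (tensor_diff (frag_of g))) \<subseteq> {}"
      by (simp add: tensor_diff_tensor_diff_frag_of)
  qed (simp add: tensor_diff_subtract)
  then show ?thesis
    by simp
qed

lemma keys_homotopy_defect:
  assumes "s \<in> K" and u: "Poly_Mapping.keys u \<subseteq> cells s t n"
    and small: "\<And>a b. (a, b) \<in> Poly_Mapping.keys u \<Longrightarrow> card b \<le> k \<or> (a, b) = (s, s)"
  shows "Poly_Mapping.keys (homotopy_defect s u) \<subseteq> {(a, b). card b < k} \<union> {(s, s)}"
proof (rule keys_additive_subset[where \<Phi> = "homotopy_defect s"])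
  fix g assume g: "g \<in> Poly_Mapping.keys u"
  then obtain a b where ab: "g = (a, b)" "b \<in> K" "s \<subseteq> a" "a \<subseteq> b"
    using u by (auto simp: cells_def)
  show "Poly_Mapping.keys (homotopy_defect s (frag_of g)) \<subseteq> {(a, b). card b < k} \<union> {(s, s)}"
  proof (cases "b = s")
    case True
    then have "g = (s, s)"
      using ab by auto
    then show ?thesis
      using assms(1) by (simp add: homotopy_defect_bottom)
  next
    case False
    then have "card b \<le> k"
      using small[of a b] g ab by auto
    then show ?thesis
      using keys_homotopy_defect_frag_of[OF assms(1) ab(2,3,4) False] unfolding ab(1) by fastforce
  qed
qed (simp add: homotopy_defect_def contraction_subtract tensor_diff_subtract)

text \<open>
  On cycles the defect is subtraction of a boundary, and it moves the support into strictly smaller columns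
  except at \<open>(s, s)\<close>, which it fixes. Iterating it leaves only \<open>(s, s)\<close>. This replaces the spectral
  sequence of the filtration.
\<close>

lemma cycle_homologous_to_bottom:
  assumes "s \<in> K" and "Poly_Mapping.keys z \<subseteq> cells s t n" and "tensor_diff z = 0"
  obtains w where "Poly_Mapping.keys w \<subseteq> cells s t (n + 1)" "Poly_Mapping.keys (z - tensor_diff w) \<subseteq> {(s, s)}"
proof -
  have main: "\<exists>w. Poly_Mapping.keys w \<subseteq> cells s t (n + 1) \<and> Poly_Mapping.keys (z - tensor_diff w) \<subseteq> {(s, s)}"
    if "Poly_Mapping.keys z \<subseteq> cells s t n" "tensor_diff z = 0"
      "Poly_Mapping.keys z \<subseteq> {(a, b). card b < k} \<union> {(s, s)}" for z k
    using that
  proof (induction k arbitrary: z)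
    case 0
    then show ?case
      by (intro exI[of _ 0]) (auto simp: tensor_diff_0)
  next
    case (Suc k)
    define h z' where "h = contraction s z" and "z' = z - tensor_diff h"
    have h: "Poly_Mapping.keys h \<subseteq> cells s t (n + 1)"
      unfolding h_def by (rule contraction_cells[OF Suc.prems(1) assms(1)])
    \<comment> \<open>on a cycle the last term of the defect vanishes\<close>
    have "z' = homotopy_defect s z"
      using Suc.prems(2) by (simp add: z'_def h_def homotopy_defect_def contraction_def)
    moreover have "card b \<le> k \<or> (a, b) = (s, s)" if "(a, b) \<in> Poly_Mapping.keys z" for a b
      using subsetD[OF Suc.prems(3) that] by auto
    ultimately have "Poly_Mapping.keys z' \<subseteq> {(a, b). card b < k} \<union> {(s, s)}"
      using keys_homotopy_defect[OF assms(1) Suc.prems(1)] by simp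
    moreover have "Poly_Mapping.keys z' \<subseteq> cells s t n"
      using tensor_diff_cells[OF h] Suc.prems(1) keys_diff[of z "tensor_diff h"] by (auto simp: z'_def)
    moreover have "tensor_diff z' = 0"
      using tensor_diff_tensor_diff[OF h] Suc.prems(2) by (simp add: z'_def tensor_diff_subtract)
    ultimately obtain w where w: "Poly_Mapping.keys w \<subseteq> cells s t (n + 1)"
      "Poly_Mapping.keys (z' - tensor_diff w) \<subseteq> {(s, s)}"
      using Suc.IH by blast
    have "Poly_Mapping.keys (h + w) \<subseteq> cells s t (n + 1)"
      using h w(1) keys_add[of h w] by blast
    moreover have "z - tensor_diff (h + w) = z' - tensor_diff w"
      by (simp add: z'_def tensor_diff_add)
    ultimately show ?case
      using w(2) by metis
  qed
  have "\<exists>k. \<forall>g\<in>Poly_Mapping.keys z. card (snd g) < k"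
    using finite_nat_set_iff_bounded[of "(\<lambda>g. card (snd g)) ` Poly_Mapping.keys z"] by simp
  then obtain k where "\<forall>g\<in>Poly_Mapping.keys z. card (snd g) < k" ..
  then have "Poly_Mapping.keys z \<subseteq> {(a, b). card b < k} \<union> {(s, s)}"
    by auto
  then show thesis
    using main[OF assms(2,3)] that by blast
qed

end


section \<open>Homology of chain complexes\<close>

text \<open>
  The map has the form in which induced maps on homology are given; on a coset of \<open>x\<close> it takes the coset of
  \<open>h x\<close> as its value, because \<open>B\<close> absorbs \<open>h ` A\<close>.
\<close>

lemma quotient_map_iso:
  assumes "comm_group G" "comm_group H" and A: "subgroup A G" and B: "subgroup B H"
    and h: "h \<in> hom G H" and hA: "h ` A \<subseteq> B"
    and inj: "\<And>x. \<lbrakk>x \<in> carrier G; h x \<in> B\<rbrakk> \<Longrightarrow> x \<in> A"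
    and surj: "\<And>y. y \<in> carrier H \<Longrightarrow> \<exists>x\<in>carrier G. \<exists>b\<in>B. y = b \<otimes>\<^bsub>H\<^esub> h x"
  shows "(\<lambda>X. B <#>\<^bsub>H\<^esub> h ` X) \<in> iso (G Mod A) (H Mod B)"
proof -
  interpret G: comm_group G by fact
  interpret H: comm_group H by fact
  interpret A: subgroup A G by fact
  interpret B: subgroup B H by fact
  have nA: "A \<lhd> G" and nB: "B \<lhd> H"
    using A B by (simp_all add: G.subgroup_imp_normal H.subgroup_imp_normal)
  have hc: "h x \<in> carrier H" if "x \<in> carrier G" for x
    using hom_in_carrier[OF h that] .
  let ?q = "\<lambda>X. B <#>\<^bsub>H\<^esub> h ` X"
  have q: "?q (A #>\<^bsub>G\<^esub> x) = B #>\<^bsub>H\<^esub> h x" if x: "x \<in> carrier G" for x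
  proof
    show "?q (A #>\<^bsub>G\<^esub> x) \<subseteq> B #>\<^bsub>H\<^esub> h x"
    proof
      fix y assume "y \<in> ?q (A #>\<^bsub>G\<^esub> x)"
      then obtain b a where ba: "b \<in> B" "a \<in> A" "y = b \<otimes>\<^bsub>H\<^esub> h (a \<otimes>\<^bsub>G\<^esub> x)"
        by (auto simp: set_mult_def r_coset_def)
      then have "y = (b \<otimes>\<^bsub>H\<^esub> h a) \<otimes>\<^bsub>H\<^esub> h x"
        using x by (simp add: hom_mult[OF h] H.m_assoc hc)
      moreover have "b \<otimes>\<^bsub>H\<^esub> h a \<in> B"
        using ba hA by (intro B.m_closed) auto
      ultimately show "y \<in> B #>\<^bsub>H\<^esub> h x"
        by (auto simp: r_coset_def)
    qed
    have "x \<in> A #>\<^bsub>G\<^esub> x"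
      by (rule G.rcos_self[OF x A])
    then show "B #>\<^bsub>H\<^esub> h x \<subseteq> ?q (A #>\<^bsub>G\<^esub> x)"
      by (force simp: set_mult_def r_coset_def)
  qed
  have "?q \<in> hom (G Mod A) (H Mod B)"
  proof (rule homI)
    fix X assume "X \<in> carrier (G Mod A)"
    then show "?q X \<in> carrier (H Mod B)"
      by (auto simp: carrier_FactGroup q hc)
  next
    fix X Y assume "X \<in> carrier (G Mod A)" "Y \<in> carrier (G Mod A)"
    then obtain x y where "x \<in> carrier G" "X = A #>\<^bsub>G\<^esub> x" "y \<in> carrier G" "Y = A #>\<^bsub>G\<^esub> y"
      by (auto simp: carrier_FactGroup)
    then show "?q (X \<otimes>\<^bsub>G Mod A\<^esub> Y) = ?q X \<otimes>\<^bsub>H Mod B\<^esub> ?q Y"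
      by (simp add: normal.rcos_sum[OF nA] normal.rcos_sum[OF nB] q hc hom_mult[OF h])
  qed
  then interpret q: group_hom "G Mod A" "H Mod B" ?q
    by (simp add: group_hom_def group_hom_axioms_def normal.factorgroup_is_group nA nB)
  show ?thesis
    unfolding q.iso_iff
  proof (intro conjI ballI impI subsetI)
    fix Y assume "Y \<in> carrier (H Mod B)"
    then obtain y where y: "y \<in> carrier H" "Y = B #>\<^bsub>H\<^esub> y"
      by (auto simp: carrier_FactGroup)
    obtain x b where x: "x \<in> carrier G" and b: "b \<in> B" and yb: "y = b \<otimes>\<^bsub>H\<^esub> h x"
      using surj[OF y(1)] by blast
    have "y \<in> B #>\<^bsub>H\<^esub> h x"
      using b yb by (auto simp: r_coset_def)
    then have "Y = ?q (A #>\<^bsub>G\<^esub> x)"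
      using H.repr_independence[OF _ hc[OF x] B] by (simp add: y(2) q x)
    then show "Y \<in> ?q ` carrier (G Mod A)"
      using x by (auto simp: carrier_FactGroup)
  next
    fix X assume "X \<in> carrier (G Mod A)" and one: "?q X = \<one>\<^bsub>H Mod B\<^esub>"
    then obtain x where x: "x \<in> carrier G" "X = A #>\<^bsub>G\<^esub> x"
      by (auto simp: carrier_FactGroup)
    then have "h x \<in> B"
      using one q H.rcos_self[OF hc[OF x(1)] B] by simp
    then show "X = \<one>\<^bsub>G Mod A\<^esub>"
      using G.coset_join2[OF x(1) A inj[OF x(1)]] x(2) by simp
  qed
qed

definition is_chain_complex :: "'a chain_complex \<Rightarrow> bool" where
  "is_chain_complex C \<longleftrightarrow> (\<forall>n. comm_group (chain_group C n)) \<and>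
     (\<forall>n. boundary C n \<in> hom (chain_group C n) (chain_group C (n - 1))) \<and>
     (\<forall>n. \<forall>c\<in>carrier (chain_group C n). boundary C (n - 1) (boundary C n c) = \<one>\<^bsub>chain_group C (n - 2)\<^esub>)"

lemma is_chain_complex_pc_at:
  "\<lbrakk>is_pmodule_complex P C; x \<in> carrier P\<rbrakk> \<Longrightarrow> is_chain_complex (pc_at C x)"
  by (simp add: is_pmodule_complex_def is_chain_complex_def is_pmodule_def is_pmodule_hom_def pc_at_def)

lemma
  assumes "is_chain_complex C"
  shows comm_group_cycle_group: "comm_group (cycle_group C n)"
    and carrier_cycle_group: "carrier (cycle_group C n) =
      {c \<in> carrier (chain_group C n). boundary C n c = \<one>\<^bsub>chain_group C (n - 1)\<^esub>}"
    and mult_cycle_group: "monoid.mult (cycle_group C n) = monoid.mult (chain_group C n)"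
    and subgroup_boundaries: "subgroup (boundaries C n) (cycle_group C n)"
proof -
  have grp: "comm_group (chain_group C m)" and hom: "boundary C m \<in> hom (chain_group C m) (chain_group C (m - 1))" for m
    using assms by (auto simp: is_chain_complex_def)
  have gh: "group_hom (chain_group C m) (chain_group C (m - 1)) (boundary C m)" for m
    using grp[of m] grp[of "m - 1"] hom[of m]
    by (simp add: group_hom_def group_hom_axioms_def comm_group_def)
  interpret G: comm_group "chain_group C n" by (rule grp)
  interpret d: group_hom "chain_group C n" "chain_group C (n - 1)" "boundary C n" by (rule gh)
  show "comm_group (cycle_group C n)"
    unfolding cycle_group_def by (rule G.abelian_subgroup_generated) (rule grp)
  show car: "carrier (cycle_group C n) =
      {c \<in> carrier (chain_group C n). boundary C n c = \<one>\<^bsub>chain_group C (n - 1)\<^esub>}"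
    unfolding cycle_group_def subgroup.carrier_subgroup_generated_subgroup[OF d.subgroup_kernel]
    by (simp add: kernel_def)
  show "monoid.mult (cycle_group C n) = monoid.mult (chain_group C n)"
    by (simp add: cycle_group_def)
  have bd: "boundary C (n + 1) \<in> hom (chain_group C (n + 1)) (chain_group C n)"
    using hom[of "n + 1"] by simp
  have "subgroup (boundaries C n) (chain_group C n)"
    using group_hom.img_is_subgroup[OF gh[of "n + 1"]] by (simp add: boundaries_def)
  moreover have "boundaries C n \<subseteq> carrier (cycle_group C n)"
    unfolding car boundaries_def
  proof safe
    fix c assume c: "c \<in> carrier (chain_group C (n + 1))"
    show "boundary C (n + 1) c \<in> carrier (chain_group C n)"
      by (rule hom_in_carrier[OF bd c])
    have "\<forall>c\<in>carrier (chain_group C (n + 1)). boundary C (n + 1 - 1) (boundary C (n + 1) c) = \<one>\<^bsub>chain_group C (n + 1 - 2)\<^esub>"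
      using assms unfolding is_chain_complex_def by blast
    then show "boundary C n (boundary C (n + 1) c) = \<one>\<^bsub>chain_group C (n - 1)\<^esub>"
      using c by simp
  qed
  ultimately show "subgroup (boundaries C n) (cycle_group C n)"
    unfolding cycle_group_def G.subgroup_subgroup_generated_iff by simp
qed

lemma group_homology: "is_chain_complex C \<Longrightarrow> group (homology C n)"
  unfolding homology_def
  by (intro normal.factorgroup_is_group comm_group.subgroup_imp_normal comm_group_cycle_group subgroup_boundaries)

text \<open>
  Testing an isomorphism on homology with cycles instead of classes: a cycle must be a boundary if its
  image is one, and each cycle of the target must be the image of a cycle up to a boundary.
\<close>

lemma homology_map_iso:
  assumes C: "is_chain_complex C" and D: "is_chain_complex D"
    and f: "\<And>m. f m \<in> hom (chain_group C m) (chain_group D m)"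
    and chain: "\<And>m c. c \<in> carrier (chain_group C m) \<Longrightarrow> f (m - 1) (boundary C m c) = boundary D m (f m c)"
    and inj: "\<And>z. \<lbrakk>z \<in> carrier (chain_group C n); boundary C n z = \<one>\<^bsub>chain_group C (n - 1)\<^esub>;
        f n z \<in> boundaries D n\<rbrakk> \<Longrightarrow> z \<in> boundaries C n"
    and surj: "\<And>y. \<lbrakk>y \<in> carrier (chain_group D n); boundary D n y = \<one>\<^bsub>chain_group D (n - 1)\<^esub>\<rbrakk> \<Longrightarrow>
        \<exists>z\<in>carrier (chain_group C n). boundary C n z = \<one>\<^bsub>chain_group C (n - 1)\<^esub> \<and>
          (\<exists>b\<in>boundaries D n. y = b \<otimes>\<^bsub>chain_group D n\<^esub> f n z)"
  shows "homology_map D n (f n) \<in> iso (homology C n) (homology D n)"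
proof -
  have "homology_map D n (f n) = (\<lambda>X. boundaries D n <#>\<^bsub>cycle_group D n\<^esub> f n ` X)"
    by (simp add: fun_eq_iff homology_map_def set_mult_def mult_cycle_group[OF D])
  moreover have "f m c \<in> carrier (chain_group D m)" if "c \<in> carrier (chain_group C m)" for m c
    by (rule hom_in_carrier[OF f that])
  moreover have f1: "f (n - 1) \<one>\<^bsub>chain_group C (n - 1)\<^esub> = \<one>\<^bsub>chain_group D (n - 1)\<^esub>"
    using f[of "n - 1"] C D by (intro hom_one) (auto simp: is_chain_complex_def comm_group_def)
  moreover have "boundary D n (f n c) = \<one>\<^bsub>chain_group D (n - 1)\<^esub>"
    if "c \<in> carrier (chain_group C n)" "boundary C n c = \<one>\<^bsub>chain_group C (n - 1)\<^esub>" for c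
    using chain[OF that(1)] that(2) f1 by simp
  moreover have "f n ` boundaries C n \<subseteq> boundaries D n"
    using chain[of _ "n + 1"] hom_in_carrier[OF f[of "n + 1"]] by (auto simp: boundaries_def)
  moreover have "\<exists>z\<in>carrier (cycle_group C n). \<exists>b\<in>boundaries D n. y = b \<otimes>\<^bsub>cycle_group D n\<^esub> f n z"
    if "y \<in> carrier (cycle_group D n)" for y
    using that surj[of y] by (auto simp: carrier_cycle_group C D mult_cycle_group)
  ultimately show ?thesis
    unfolding homology_def
    by (simp only:)
      (rule quotient_map_iso; (intro homI)?;
        auto simp: comm_group_cycle_group subgroup_boundaries carrier_cycle_group mult_cycle_group
          C D inj hom_mult[OF f])
qed

lemma chain_complex_constant_integers: "is_chain_complex (pc_at constant_integers x)"
  by (auto simp: is_chain_complex_def pc_at_def constant_integers_def abelian_integer_group hom_def Pi_def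
      singleton_group_def intro!: group.group_comm_groupI singleton_group[unfolded singleton_group_def])

lemma boundaries_constant_integers: "boundaries (pc_at constant_integers x) n = {0}"
  by (auto simp: boundaries_def pc_at_def constant_integers_def singleton_group_def)

lemma homology_constant_integers_zero: "homology (pc_at constant_integers x) 0 \<cong> integer_group"
proof -
  have "kernel integer_group (singleton_group (0::int)) (\<lambda>m. 0) = carrier integer_group"
    by (auto simp: kernel_def singleton_group_def)
  then have "cycle_group (pc_at constant_integers x) 0 = integer_group"
    using group.subgroup_generated_group_carrier[OF group_integer_group]
    by (simp add: cycle_group_def pc_at_def constant_integers_def)
  then have "homology (pc_at constant_integers x) 0 = integer_group Mod {\<one>\<^bsub>integer_group\<^esub>}"
    by (simp add: homology_def boundaries_constant_integers)
  then show ?thesis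
    using group.trivial_factor_iso[OF group_integer_group] by (auto simp: is_iso_def)
qed

lemma homology_constant_integers_nonzero:
  assumes "n \<noteq> 0"
  shows "trivial_group (homology (pc_at constant_integers x) n)"
proof -
  let ?D = "pc_at constant_integers x :: int chain_complex"
  have "carrier (cycle_group ?D n) \<subseteq> {0}"
    unfolding carrier_cycle_group[OF chain_complex_constant_integers]
    using assms by (auto simp: pc_at_def constant_integers_def singleton_group_def)
  then have "carrier (homology ?D n) \<subseteq> {boundaries ?D n #>\<^bsub>cycle_group ?D n\<^esub> 0}"
    unfolding homology_def carrier_FactGroup by blast
  then show ?thesis
    unfolding group.trivial_group_alt[OF group_homology[OF chain_complex_constant_integers]] ..
qed

lemma pmodule_complex_constant_integers: "is_pmodule_complex P constant_integers"
  unfolding is_pmodule_complex_def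
proof (intro conjI allI ballI)
  have comm: "comm_group (if n = 0 then integer_group else singleton_group (0::int))" for n :: int
    by (auto simp: abelian_integer_group singleton_group_def intro!: group.group_comm_groupI singleton_group[unfolded singleton_group_def])
  show "is_pmodule P (pc_module constant_integers n)" for n
    using comm[of n] by (auto simp: is_pmodule_def constant_integers_def hom_def)
  show "finite {n. \<exists>x\<in>carrier P. \<not> trivial_group (pm_at (pc_module constant_integers n) x)}"
    by (rule finite_subset[of _ "{0}"]) (auto simp: constant_integers_def)
qed (auto simp: is_pmodule_hom_def constant_integers_def hom_def singleton_group_def)


section \<open>The augmentation\<close>

text \<open>
  The augmentation is the linear extension of a map on generators; in this form the linearity of
  \<open>frag_extend\<close> carries over. The one-element type \<open>unit\<close> represents the group of integers as a free
  abelian group.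
\<close>

lemma augmentation_eq_lookup:
  "augmentation n x u = Poly_Mapping.lookup (frag_extend (\<lambda>(a, b). if a = b then frag_of () else 0) u) ()"
  unfolding augmentation_def frag_extend_def lookup_sum
  by (intro sum.cong) auto

lemma augmentation_add: "augmentation n x (u + v) = augmentation n x u + augmentation n x v"
  and augmentation_diff: "augmentation n x (u - v) = augmentation n x u - augmentation n x v"
  and augmentation_cmul: "augmentation n x (frag_cmul k u) = k * augmentation n x u"
  and augmentation_sum: "finite I \<Longrightarrow> augmentation n x (\<Sum>i\<in>I. g i) = (\<Sum>i\<in>I. augmentation n x (g i))"
  and augmentation_frag_of: "augmentation n x (frag_of (a, b)) = (if a = b then 1 else 0)"
  by (simp_all add: augmentation_eq_lookup frag_extend_add frag_extend_diff frag_extend_cmul frag_extend_sum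
      lookup_add lookup_minus lookup_sum)

context oriented_complex begin

abbreviation (input) "DK \<equiv> D_poset (face_poset K)"
abbreviation (input) "CC \<equiv> cochains_tensor_chains K ori"

lemma carrier_DK: "carrier DK = {(s, t). s \<in> K \<and> t \<in> K \<and> s \<subseteq> t}"
  by (auto simp: D_poset_def face_poset_def)

lemma pm_at_cochains_tensor_chains:
  assumes "(s, t) \<in> carrier DK"
  shows "pm_at (pc_module CC n) (s, t) = free_Abelian_group (cells s t n)"
  using chain_group_cochains_tensor_chains[of s K t ori n] assms
  unfolding cells_def carrier_DK by (simp add: pc_at_def)

lemma pm_map_cochains_tensor_chains: "pm_map (pc_module CC n) x y m = m"
  by (simp add: cochains_tensor_chains_def bracket_complex_def bracket_def)

lemma pc_boundary_cochains_tensor_chains: "pc_boundary CC n x = tensor_diff"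
  by (simp add: cochains_tensor_chains_def bracket_complex_def tensor_complex_def)

lemma cells_mono: "\<lbrakk>s' \<subseteq> s; t \<subseteq> t'\<rbrakk> \<Longrightarrow> cells s t n \<subseteq> cells s' t' n"
  by (auto simp: cells_def)

lemma le_DK: "(s, t) \<sqsubseteq>\<^bsub>DK\<^esub> (s', t') \<longleftrightarrow> s' \<subseteq> s \<and> s \<subseteq> t \<and> t \<subseteq> t'"
  by (simp add: D_poset_def face_poset_def)

lemma pmodule_complex_cochains_tensor_chains: "is_pmodule_complex DK CC"
  unfolding is_pmodule_complex_def
proof (intro conjI allI ballI)
  fix n
  show "is_pmodule DK (pc_module CC n)"
    unfolding is_pmodule_def
  proof (intro conjI ballI impI)
    fix x assume "x \<in> carrier DK"
    then show "comm_group (pm_at (pc_module CC n) x)"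
      by (cases x) (simp add: pm_at_cochains_tensor_chains abelian_free_Abelian_group)
  next
    fix x y assume xy: "x \<in> carrier DK" "y \<in> carrier DK" "x \<sqsubseteq>\<^bsub>DK\<^esub> y"
    obtain s t s' t' where x: "x = (s, t)" and y: "y = (s', t')"
      by (cases x; cases y)
    have "cells s t n \<subseteq> cells s' t' n"
      using xy(3) by (intro cells_mono) (simp_all add: x y le_DK)
    then show "pm_map (pc_module CC n) x y \<in> hom (pm_at (pc_module CC n) x) (pm_at (pc_module CC n) y)"
      unfolding x y pm_at_cochains_tensor_chains[OF xy(1)[unfolded x]] pm_at_cochains_tensor_chains[OF xy(2)[unfolded y]]
      by (intro hom_free_Abelian_groupI) (simp_all add: pm_map_cochains_tensor_chains)
  qed (simp_all add: pm_map_cochains_tensor_chains)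
  show "is_pmodule_hom DK (pc_module CC n) (pc_module CC (n - 1)) (pc_boundary CC n)"
    unfolding is_pmodule_hom_def
  proof (intro conjI ballI impI)
    fix x assume "x \<in> carrier DK"
    then show "pc_boundary CC n x \<in> hom (pm_at (pc_module CC n) x) (pm_at (pc_module CC (n - 1)) x)"
      by (cases x) (simp add: pm_at_cochains_tensor_chains pc_boundary_cochains_tensor_chains
        hom_free_Abelian_groupI tensor_diff_cells tensor_diff_add)
  qed (simp_all add: pm_map_cochains_tensor_chains pc_boundary_cochains_tensor_chains)
next
  fix n x m assume "x \<in> carrier DK" "m \<in> carrier (pm_at (pc_module CC n) x)"
  then show "pc_boundary CC (n - 1) x (pc_boundary CC n x m) = \<one>\<^bsub>pm_at (pc_module CC (n - 2)) x\<^esub>"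
    by (cases x) (simp add: pm_at_cochains_tensor_chains pc_boundary_cochains_tensor_chains tensor_diff_tensor_diff)
next
  have "trivial_group (pm_at (pc_module CC n) x)"
    if "x \<in> carrier DK" "n \<notin> (\<lambda>(a, b). simplex_dim b - simplex_dim a) ` (K \<times> K)" for n x
  proof -
    obtain s t where x: "x = (s, t)" by (cases x)
    have "cells s t n = {}"
      using that(2) by (force simp: cells_def)
    then show ?thesis
      using that(1) unfolding x
      by (simp add: pm_at_cochains_tensor_chains trivial_group_def) (auto simp: free_Abelian_group_def)
  qed
  then have "{n. \<exists>x\<in>carrier DK. \<not> trivial_group (pm_at (pc_module CC n) x)}
      \<subseteq> (\<lambda>(a, b). simplex_dim b - simplex_dim a) ` (K \<times> K)"
    by blast
  then show "finite {n. \<exists>x\<in>carrier DK. \<not> trivial_group (pm_at (pc_module CC n) x)}"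
    using finite_K by (meson finite_SigmaI finite_imageI finite_subset)
qed

text \<open>
  The augmentation sees only the diagonal, which the differential of \<open>(a, b)\<close> meets when \<open>a\<close> is a facet of
  \<open>b\<close>: at \<open>(a, a)\<close> through the boundary and at \<open>(b, b)\<close> through the coboundary. Both coefficients are the
  same incidence number, with opposite signs.
\<close>

lemma augmentation_tensor_diff:
  assumes "Poly_Mapping.keys u \<subseteq> cells s t n"
  shows "augmentation m x (tensor_diff u) = 0"
proof -
  have gen: "augmentation m x (tensor_diff (frag_of (a, b))) = 0" if "a \<in> K" "b \<in> K" "a \<subseteq> b" for a b
  proof -
    have fin: "finite {a..b}" and "a \<in> {a..b}" "b \<in> {a..b}"
      using finite_interval that by auto
    then have "augmentation m x (face_sum a b) = inc b a" "augmentation m x (coface_sum a b) = inc b a"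
      unfolding face_sum_def coface_sum_def augmentation_sum[OF fin] augmentation_cmul augmentation_frag_of
      by (simp_all add: if_distrib[of "\<lambda>y. _ * y"] cong: if_cong)
    then show ?thesis
      by (simp add: tensor_diff_frag_of that augmentation_cmul augmentation_diff)
  qed
  show ?thesis
    using assms
  proof (induction u rule: frag_induction)
    case (one g)
    then show ?case
      using gen by (cases g) (simp add: cells_def)
  qed (simp_all add: tensor_diff_0 tensor_diff_subtract augmentation_diff augmentation_eq_lookup[of _ _ 0])
qed

lemma augmentation_nonzero_degree:
  assumes "Poly_Mapping.keys u \<subseteq> cells s t n" "n \<noteq> 0"
  shows "augmentation m x u = 0"
proof -
  have "\<sigma> \<noteq> \<tau>" if "(\<sigma>, \<tau>) \<in> Poly_Mapping.keys u" for \<sigma> \<tau>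
    using assms that by (auto simp: cells_def)
  then show ?thesis
    unfolding augmentation_def by (intro sum.neutral) auto
qed

lemma augmentation_hom:
  assumes "x \<in> carrier DK"
  shows "augmentation n x \<in> hom (pm_at (pc_module CC n) x) (pm_at (pc_module constant_integers n) x)"
proof -
  obtain s t where x: "x = (s, t)" by (cases x)
  have C: "pm_at (pc_module CC n) x = free_Abelian_group (cells s t n)"
    using assms unfolding x by (rule pm_at_cochains_tensor_chains)
  show ?thesis
  proof (cases "n = 0")
    case True
    then show ?thesis
      unfolding C by (intro homI) (auto simp: constant_integers_def augmentation_add)
  next
    case False
    then show ?thesis
      unfolding C using augmentation_nonzero_degree[of _ s t n]
      by (intro homI) (auto simp: constant_integers_def singleton_group_def augmentation_add)
  qed
qed

lemma augmentation_chain_map: "is_chain_map DK CC constant_integers augmentation"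
  unfolding is_chain_map_def
proof (intro conjI allI ballI)
  show "is_pmodule_hom DK (pc_module CC n) (pc_module constant_integers n) (augmentation n)" for n
    unfolding is_pmodule_hom_def
    using augmentation_hom by (auto simp: pm_map_cochains_tensor_chains constant_integers_def augmentation_def)
next
  fix n x m assume "x \<in> carrier DK" "m \<in> carrier (pm_at (pc_module CC n) x)"
  then show "augmentation (n - 1) x (pc_boundary CC n x m) =
      pc_boundary constant_integers n x (augmentation n x m)"
    by (cases x) (simp add: pm_at_cochains_tensor_chains pc_boundary_cochains_tensor_chains
        augmentation_tensor_diff constant_integers_def)
qed (simp_all add: pmodule_complex_cochains_tensor_chains pmodule_complex_constant_integers)

text \<open>
  Every cycle is homologous to a multiple of the generator \<open>(s, s)\<close>, and the augmentation reads off that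
  multiple because it is \<open>1\<close> on \<open>(s, s)\<close> and vanishes on boundaries. This settles all degrees at once: in
  nonzero degrees the augmentation is zero, hence so is the multiple.
\<close>

lemma augmentation_homology_iso:
  assumes "x \<in> carrier DK"
  shows "homology_map (pc_at constant_integers x) n (augmentation n x)
    \<in> iso (homology (pc_at CC x) n) (homology (pc_at constant_integers x) n)"
proof -
  obtain s t where x: "x = (s, t)" by (cases x)
  have sK: "s \<in> K" and "t \<in> K" "s \<subseteq> t"
    using assms by (auto simp: x carrier_DK)
  then have bottom: "(s, s) \<in> cells s t 0"
    by (simp add: cells_def)
  let ?C = "pc_at CC x" and ?D = "pc_at constant_integers x :: int chain_complex"
  have chain_group: "chain_group ?C m = free_Abelian_group (cells s t m)" for m
    using pm_at_cochains_tensor_chains assms unfolding x by (simp add: pc_at_def)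
  have boundary: "boundary ?C m = tensor_diff" for m
    by (simp add: pc_at_def pc_boundary_cochains_tensor_chains)
  show ?thesis
  proof (rule homology_map_iso[where f = "\<lambda>m. augmentation m x"])
    show "is_chain_complex ?C"
      by (rule is_chain_complex_pc_at[OF pmodule_complex_cochains_tensor_chains assms])
    show "is_chain_complex ?D"
      by (rule chain_complex_constant_integers)
    show "augmentation m x \<in> hom (chain_group ?C m) (chain_group ?D m)" for m
      using augmentation_hom[OF assms] by (simp add: pc_at_def)
    show "augmentation (m - 1) x (boundary ?C m c) = boundary ?D m (augmentation m x c)"
      if "c \<in> carrier (chain_group ?C m)" for m c
      using that augmentation_tensor_diff unfolding chain_group boundary
      by (simp add: pc_at_def constant_integers_def)
  next
    fix z assume z: "z \<in> carrier (chain_group ?C n)" "boundary ?C n z = \<one>\<^bsub>chain_group ?C (n - 1)\<^esub>"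
      and "augmentation n x z \<in> boundaries ?D n"
    then have z0: "augmentation n x z = 0"
      by (simp add: boundaries_constant_integers)
    obtain w where w: "Poly_Mapping.keys w \<subseteq> cells s t (n + 1)" "Poly_Mapping.keys (z - tensor_diff w) \<subseteq> {(s, s)}"
      using cycle_homologous_to_bottom[OF sK, of z t n] z unfolding chain_group boundary by auto
    let ?r = "z - tensor_diff w"
    have "augmentation n x ?r = 0"
      using z0 augmentation_tensor_diff[OF w(1)] by (simp add: augmentation_diff)
    moreover have "augmentation n x ?r = (\<Sum>(\<sigma>, \<tau>)\<in>{(s, s)}. Poly_Mapping.lookup ?r (\<sigma>, \<tau>) * (if \<sigma> = \<tau> then 1 else 0))"
      unfolding augmentation_def by (rule sum.mono_neutral_left) (use w(2) in \<open>auto simp: in_keys_iff\<close>)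
    ultimately have "Poly_Mapping.lookup ?r (s, s) = 0"
      by simp
    then have "(s, s) \<notin> Poly_Mapping.keys ?r"
      by (simp only: in_keys_iff simp_thms)
    then have "Poly_Mapping.keys ?r = {}"
      using w(2) by blast
    then have "?r = 0"
      by (simp only: keys_eq_empty)
    then have "z = tensor_diff w"
      by (simp only: right_minus_eq)
    then show "z \<in> boundaries ?C n"
      using w(1) by (auto simp: boundaries_def chain_group boundary)
  next
    fix y assume y: "y \<in> carrier (chain_group ?D n)"
    show "\<exists>z\<in>carrier (chain_group ?C n). boundary ?C n z = \<one>\<^bsub>chain_group ?C (n - 1)\<^esub> \<and>
        (\<exists>b\<in>boundaries ?D n. y = b \<otimes>\<^bsub>chain_group ?D n\<^esub> augmentation n x z)"
    proof (cases "n = 0")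
      case True
      have "Poly_Mapping.keys (frag_cmul y (frag_of (s, s))) \<subseteq> cells s t n"
        using bottom True by auto
      moreover have "tensor_diff (frag_cmul y (frag_of (s, s))) = 0"
        by (simp add: tensor_diff_cmul tensor_diff_bottom sK)
      moreover have "y = 0 \<otimes>\<^bsub>chain_group ?D n\<^esub> augmentation n x (frag_cmul y (frag_of (s, s)))"
        using True by (simp add: augmentation_cmul augmentation_frag_of pc_at_def constant_integers_def)
      ultimately show ?thesis
        unfolding chain_group boundary boundaries_constant_integers
        by (intro bexI[of _ "frag_cmul y (frag_of (s, s))"]) auto
    next
      case False
      then have "y = 0" and "chain_group ?D n = singleton_group 0"
        using y by (auto simp: pc_at_def constant_integers_def singleton_group_def)
      then show ?thesis
        unfolding chain_group boundary boundaries_constant_integers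
        by (intro bexI[of _ 0]) (simp_all add: tensor_diff_0 singleton_group_def)
    qed
  qed
qed

end

theorem corollary32:
  fixes K :: "'v set set" and ori :: "'v set \<Rightarrow> 'v list"
  assumes "finite_simplicial_complex K" and "orientation K ori"
  shows "(\<forall>\<sigma>\<in>K. \<forall>\<tau>\<in>K. \<sigma> \<subseteq> \<tau> \<longrightarrow>
            (\<forall>i>0. trivial_group (homology (pc_at (cochains_tensor_chains K ori) (\<sigma>, \<tau>)) i)) \<and>
            cyclic_group (homology (pc_at (cochains_tensor_chains K ori) (\<sigma>, \<tau>)) 0) \<and>
            infinite (carrier (homology (pc_at (cochains_tensor_chains K ori) (\<sigma>, \<tau>)) 0))) \<and>
         weak_equivalence (D_poset (face_poset K)) (cochains_tensor_chains K ori)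
           constant_integers augmentation"
proof -
  interpret oriented_complex K ori
    by unfold_locales (use assms in auto)
  have "(\<forall>i>0. trivial_group (homology (pc_at (cochains_tensor_chains K ori) (\<sigma>, \<tau>)) i)) \<and>
      cyclic_group (homology (pc_at (cochains_tensor_chains K ori) (\<sigma>, \<tau>)) 0) \<and>
      infinite (carrier (homology (pc_at (cochains_tensor_chains K ori) (\<sigma>, \<tau>)) 0))"
    if "\<sigma> \<in> K" "\<tau> \<in> K" "\<sigma> \<subseteq> \<tau>" for \<sigma> \<tau>
  proof -
    let ?C = "pc_at (cochains_tensor_chains K ori) (\<sigma>, \<tau>)"
    let ?D = "pc_at constant_integers (\<sigma>, \<tau>) :: int chain_complex"
    have x: "(\<sigma>, \<tau>) \<in> carrier (D_poset (face_poset K))"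
      using that by (simp add: carrier_DK)
    have grp: "group (homology ?C n)" "group (homology ?D n)" for n
      using is_chain_complex_pc_at[OF pmodule_complex_cochains_tensor_chains x]
      by (simp_all add: group_homology chain_complex_constant_integers)
    have iso: "homology ?C n \<cong> homology ?D n" for n
      using augmentation_homology_iso[OF x] by (rule is_isoI)
    then have "homology ?C 0 \<cong> integer_group"
      using homology_constant_integers_zero by (rule iso_trans)
    then have "cyclic_group (homology ?C 0)" "infinite (carrier (homology ?C 0))"
      using isomorphic_group_cyclicity[OF _ grp(1) group_integer_group]
        eqpoll_finite_iff[OF iso_imp_eqpoll_carrier, of "homology ?C 0" integer_group] by auto
    moreover have "trivial_group (homology ?C i)" if "i > 0" for i
      using isomorphic_group_triviality[OF iso grp(1) grp(2)] homology_constant_integers_nonzero[of i] that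
      by simp
    ultimately show ?thesis
      by blast
  qed
  then show ?thesis
    unfolding weak_equivalence_def using augmentation_chain_map augmentation_homology_iso by blast
qed

end
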